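(* Let $A=\langle X\mid R\rangle$ be a finitely presented group with finite generating set $X$, and let $(G, X\cup\{s_i\}_{i=1}^n)$ be an isometric multiple HNN extension with base group $(A,X)$ and stable letters $s_1,\dots,s_n$. If $(A,X)$ has the falsification by fellow traveler property, then $G$ is almost convex with respect to the generating set $X\cup\{s_i\}_{i=1}^n$.
   Context: For a group $G$ with finite generating set $X$, $\Gamma(G,X)$ is the Cayley graph with its path metric $d$ (each edge has length 1). Words are over generators and their inverses; $|w|$ denotes the length of a word $w$. A word is geodesic (for $(G,X)$) if no shorter word represents the same group element. For a word $w$ viewed as a path in the Cayley graph from the identity, $w(t)$ is the point at distance $t\ge 0$ along the path, with $w(t)$ equal to the endpoint of the path for $t\ge |w|$. Almost convex: $(G,X)$ is almost convex if there is a constant $C>0$ such that for every $N$ and every pair of elements $g,g'$ in the metric sphere of radius $N$ about the identity with $d(g,g')\le 2$ in $\Gamma(G,X)$, there is a path of length at most $C$ from $g$ to $g'$ which runs inside the metric ball of radius $N$ about the identity. Falsification by fellow traveler property: $(G,X)$ has this property if there is a constant $k>0$ such that for every non-geodesic word $w$ there is a shorter word $u$, representing the same group element as $w$, that $k$-fellow travels $w$, i.e. $d(w(t),u(t))\le k$ in $\Gamma(G,X)$ for all $t\ge 0$. Multiple HNN extension: let $A=\langle X\mid R\rangle$ with $X$ finite, and let $\phi_i:U_i\to V_i$, $i=1,\dots,n$, be isomorphisms between subgroups $U_i,V_i$ of $A$ (the associated subgroups). The multiple HNN extension of $(A,X)$ with these isomorphisms is $$G=\langle X,s_1,\dots,s_n\mid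 R,\ s_i^{-1}us_i=\phi_i(u)\ (u\in U_i,\ 1\le i\le n)\rangle,$$ and the $s_i$ are called stable letters. When each $U_i$ is finitely generated, by $u_{i1},\dots,u_{im_i}$, put $v_{ij}=\phi_i(u_{ij})$, so that $V_i$ is generated by $v_{i1},\dots,v_{im_i}$; then $$G=\langle X,s_1,\dots,s_n\mid R,\ s_i^{-1}u_{ij}s_i=v_{ij}\ (1\le i\le n,\ 1\le j\le m_i)\rangle .$$ Here the $u_{ij}$ and $v_{ij}$ are given as fixed words over $X^{\pm1}$, so every word in the letters $u_{ij}^{\pm1}$ (or $v_{ij}^{\pm1}$) is also read as a word over $X^{\pm1}$ by concatenation. Geodesic, totally geodesic, strip equidistant: the associated subgroups are geodesic if, for every $i$, each freely reduced word in $\{u_{i1}^{\pm1},\dots,u_{im_i}^{\pm1}\}^*$ and each freely reduced word in $\{v_{i1}^{\pm1},\dots,v_{im_i}^{\pm1}\}^*$ is, read over $X^{\pm1}$, a geodesic word for $(A,X)$. They are totally geodesic if, for every $i$, each geodesic word $w$ over $X^{\pm1}$ (for $(A,X)$) representing an element of $U_i$ [respectively $V_i$] lies in $\{u_{i1}^{\pm1},\dots,u_{im_i}^{\pm1}\}^*$ [respectively $\{v_{i1}^{\pm1},\dots,v_{im_i}^{\pm1}\}^*$], i.e. is a concatenation of these words. (Totally geodesic associated subgroups are understood to be geodesic.) Geodesic associated subgroups are strip equidistant if $|u_{ij}|=|v_{ij}|$ for all $i,j$. The presentation of the multiple HNN extension is totally geodesic [respectively strip equidistant] if all the associated subgroups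 are. Isometric multiple HNN extension: a multiple HNN extension $G=\langle X,s_1,\dots,s_n\mid R,\ s_i^{-1}u_{ij}s_i=v_{ij}\ (1\le i\le n,\ 1\le j\le m_i)\rangle$ of a finitely presented group $A=\langle X\mid R\rangle$, with isomorphisms $\phi_i:U_i\to V_i$ between subgroups of $A$, where $u_{i1},\dots,u_{im_i}$ generate $U_i$ and $v_{ij}=\phi_i(u_{ij})$, in which all $U_i,V_i$ are finitely generated free subgroups of $A$, and whose presentation is strip equidistant and totally geodesic. *)

theory Defs
  imports Complex_Main "HOL-Algebra.Generated_Groups"
begin

section \<open>Words and presented groups\<close>

text \<open>The letter \<open>(x, True)\<close> stands for the generator \<open>x\<close> and \<open>(x, False)\<close> for its formal inverse.\<close>

type_synonym 'x letter = "'x \<times> bool"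
type_synonym 'x word = "'x letter list"

definition letter_inv :: "'x letter \<Rightarrow> 'x letter" where
  "letter_inv a = (fst a, \<not> snd a)"

definition word_inv :: "'x word \<Rightarrow> 'x word" where
  "word_inv w = rev (map letter_inv w)"

definition words :: "'x set \<Rightarrow> 'x word set" where
  "words X = lists (X \<times> UNIV)"

definition freely_reduced :: "'x word \<Rightarrow> bool" where
  "freely_reduced w \<longleftrightarrow> (\<nexists>p a q. w = p @ [a, letter_inv a] @ q)"

text \<open>Equality in \<open>\<langle>X | R\<rangle>\<close>: the least equivalence relation on words over \<open>X\<close> that allows
  inserting and deleting the words \<open>a a\<inverse>\<close> and the relators.\<close>

inductive_set pres_rel :: "'x set \<Rightarrow> 'x word set \<Rightarrow> ('x word \<times> 'x word) set"
  for X :: "'x set" and R :: "'x word set" where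
  refl: "w \<in> words X \<Longrightarrow> (w, w) \<in> pres_rel X R"
| sym: "(w, w') \<in> pres_rel X R \<Longrightarrow> (w', w) \<in> pres_rel X R"
| trans: "(w, w') \<in> pres_rel X R \<Longrightarrow> (w', w'') \<in> pres_rel X R \<Longrightarrow> (w, w'') \<in> pres_rel X R"
| cancel: "p \<in> words X \<Longrightarrow> q \<in> words X \<Longrightarrow> fst a \<in> X
    \<Longrightarrow> (p @ [a, letter_inv a] @ q, p @ q) \<in> pres_rel X R"
| relator: "p \<in> words X \<Longrightarrow> q \<in> words X \<Longrightarrow> r \<in> R \<Longrightarrow> r \<in> words X
    \<Longrightarrow> (p @ r @ q, p @ q) \<in> pres_rel X R"

definition presented_group :: "'x set \<Rightarrow> 'x word set \<Rightarrow> 'x word set monoid" where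
  "presented_group X R =
    \<lparr> carrier = words X // pres_rel X R,
      mult = (\<lambda>P Q. \<Union>p\<in>P. \<Union>q\<in>Q. pres_rel X R `` {p @ q}),
      one = pres_rel X R `` {[]} \<rparr>"

definition presented_gen :: "'x set \<Rightarrow> 'x word set \<Rightarrow> 'x \<Rightarrow> 'x word set" where
  "presented_gen X R x = pres_rel X R `` {[(x, True)]}"

text \<open>A free group is one isomorphic to a group \<open>\<langle>B | \<rangle>\<close>. Taking \<open>B\<close> in the element type of \<open>H\<close> is
  no restriction, since a basis of \<open>H\<close> is a subset of \<open>H\<close>.\<close>

definition free_group :: "('g, 'm) monoid_scheme \<Rightarrow> bool" where
  "free_group H \<longleftrightarrow> group H \<and> (\<exists>B :: 'g set. H \<cong> presented_group B {})"


section \<open>The Cayley graph of a group with a generating set\<close>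

text \<open>Throughout, \<open>X\<close> is a set of generator symbols, and \<open>\<iota>\<close> sends each symbol to the element of \<open>G\<close>
  it represents; \<open>\<iota>\<close> need not be injective.\<close>

fun word_val :: "('g, 'm) monoid_scheme \<Rightarrow> ('x \<Rightarrow> 'g) \<Rightarrow> 'x word \<Rightarrow> 'g" where
  "word_val G \<iota> [] = \<one>\<^bsub>G\<^esub>"
| "word_val G \<iota> ((x, e) # w) = (if e then \<iota> x else inv\<^bsub>G\<^esub> (\<iota> x)) \<otimes>\<^bsub>G\<^esub> word_val G \<iota> w"

definition geodesic_word :: "('g, 'm) monoid_scheme \<Rightarrow> ('x \<Rightarrow> 'g) \<Rightarrow> 'x set \<Rightarrow> 'x word \<Rightarrow> bool" where
  "geodesic_word G \<iota> X w \<longleftrightarrow> w \<in> words X \<and>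
     (\<nexists>w'. w' \<in> words X \<and> word_val G \<iota> w' = word_val G \<iota> w \<and> length w' < length w)"

definition vertex_dist :: "('g, 'm) monoid_scheme \<Rightarrow> ('x \<Rightarrow> 'g) \<Rightarrow> 'x set \<Rightarrow> 'g \<Rightarrow> 'g \<Rightarrow> nat" where
  "vertex_dist G \<iota> X g h =
     (LEAST l. \<exists>w \<in> words X. length w = l \<and> g \<otimes>\<^bsub>G\<^esub> word_val G \<iota> w = h)"

text \<open>\<open>Edge_Point g x r\<close>, with \<open>0 \<le> r \<le> 1\<close>, is the point at distance \<open>r\<close> from \<open>g\<close> along the edge
  labelled \<open>x\<close> from \<open>g\<close> to \<open>g x\<close>. For \<open>r = 0\<close> and \<open>r = 1\<close> it is at distance 0 from the corresponding
  endpoint, though a different term.\<close>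

datatype ('g, 'x) cayley_point = Vertex 'g | Edge_Point 'g 'x real

fun exits :: "('g, 'm) monoid_scheme \<Rightarrow> ('x \<Rightarrow> 'g) \<Rightarrow> ('g, 'x) cayley_point \<Rightarrow> ('g \<times> real) set" where
  "exits G \<iota> (Vertex g) = {(g, 0)}"
| "exits G \<iota> (Edge_Point g x r) = {(g, r), (g \<otimes>\<^bsub>G\<^esub> \<iota> x, 1 - r)}"

definition dist_via_vertices ::
  "('g, 'm) monoid_scheme \<Rightarrow> ('x \<Rightarrow> 'g) \<Rightarrow> 'x set \<Rightarrow> ('g, 'x) cayley_point \<Rightarrow> ('g, 'x) cayley_point \<Rightarrow> real"
  where
  "dist_via_vertices G \<iota> X p q =
     Min ((\<lambda>((g, r), (h, s)). r + real (vertex_dist G \<iota> X g h) + s) ` (exits G \<iota> p \<times> exits G \<iota> q))"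

text \<open>The path metric of the Cayley graph with edges of length 1: a shortest path between two points
  either stays inside one edge or passes through endpoints of the edges containing the points.\<close>

fun cayley_dist ::
  "('g, 'm) monoid_scheme \<Rightarrow> ('x \<Rightarrow> 'g) \<Rightarrow> 'x set \<Rightarrow> ('g, 'x) cayley_point \<Rightarrow> ('g, 'x) cayley_point \<Rightarrow> real"
  where
  "cayley_dist G \<iota> X (Edge_Point g x r) (Edge_Point h y s) =
     (if g = h \<and> x = y
      then min \<bar>r - s\<bar> (dist_via_vertices G \<iota> X (Edge_Point g x r) (Edge_Point h y s))
      else dist_via_vertices G \<iota> X (Edge_Point g x r) (Edge_Point h y s))"
| "cayley_dist G \<iota> X p q = dist_via_vertices G \<iota> X p q"

text \<open>\<open>path_point G \<iota> g w t\<close> is the point at distance \<open>t \<ge> 0\<close> along the path labelled \<open>w\<close> that starts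
  at the vertex \<open>g\<close>. An inverse letter traverses an edge backwards.\<close>

definition path_point ::
  "('g, 'm) monoid_scheme \<Rightarrow> ('x \<Rightarrow> 'g) \<Rightarrow> 'g \<Rightarrow> 'x word \<Rightarrow> real \<Rightarrow> ('g, 'x) cayley_point" where
  "path_point G \<iota> g w t =
    (if t \<ge> real (length w) then Vertex (g \<otimes>\<^bsub>G\<^esub> word_val G \<iota> w)
     else let j = nat \<lfloor>t\<rfloor>; h = g \<otimes>\<^bsub>G\<^esub> word_val G \<iota> (take j w); x = fst (w ! j)
          in if snd (w ! j) then Edge_Point h x (t - real j)
             else Edge_Point (h \<otimes>\<^bsub>G\<^esub> inv\<^bsub>G\<^esub> (\<iota> x)) x (1 - (t - real j)))"

definition falsification_by_fellow_traveler ::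
  "('g, 'm) monoid_scheme \<Rightarrow> ('x \<Rightarrow> 'g) \<Rightarrow> 'x set \<Rightarrow> bool" where
  "falsification_by_fellow_traveler G \<iota> X \<longleftrightarrow>
     (\<exists>k::real. k > 0 \<and>
       (\<forall>w \<in> words X. \<not> geodesic_word G \<iota> X w \<longrightarrow>
         (\<exists>u \<in> words X. length u < length w \<and> word_val G \<iota> u = word_val G \<iota> w \<and>
           (\<forall>t::real. t \<ge> 0 \<longrightarrow>
              cayley_dist G \<iota> X (path_point G \<iota> \<one>\<^bsub>G\<^esub> w t) (path_point G \<iota> \<one>\<^bsub>G\<^esub> u t) \<le> k))))"

text \<open>The ball is the metric ball of the Cayley graph, so all points of the connecting path, interior
  points of its edges included, are required to lie within distance \<open>N\<close> of the identity. In
  particular the path may not use an edge both of whose ends lie on the sphere of radius \<open>N\<close>.\<close>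

definition almost_convex :: "('g, 'm) monoid_scheme \<Rightarrow> ('x \<Rightarrow> 'g) \<Rightarrow> 'x set \<Rightarrow> bool" where
  "almost_convex G \<iota> X \<longleftrightarrow>
     (\<exists>C::real. C > 0 \<and>
       (\<forall>N::nat. \<forall>g \<in> carrier G. \<forall>g' \<in> carrier G.
          vertex_dist G \<iota> X \<one>\<^bsub>G\<^esub> g = N \<and> vertex_dist G \<iota> X \<one>\<^bsub>G\<^esub> g' = N \<and> vertex_dist G \<iota> X g g' \<le> 2
          \<longrightarrow> (\<exists>w \<in> words X. g \<otimes>\<^bsub>G\<^esub> word_val G \<iota> w = g' \<and> real (length w) \<le> C \<and>
                (\<forall>t \<in> {0..real (length w)}.
                   cayley_dist G \<iota> X (Vertex \<one>\<^bsub>G\<^esub>) (path_point G \<iota> g w t) \<le> real N))))"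


section \<open>Multiple HNN extensions\<close>

text \<open>The stable letters are \<open>Inr 1, \<dots>, Inr n\<close>.\<close>

definition hnn_gens :: "'x set \<Rightarrow> nat \<Rightarrow> ('x + nat) set" where
  "hnn_gens X n = Inl ` X \<union> Inr ` {1..n}"

definition base_word :: "'x word \<Rightarrow> ('x + nat) word" where
  "base_word w = map (\<lambda>(x, e). (Inl x, e)) w"

definition hnn_rels ::
  "'x word set \<Rightarrow> nat \<Rightarrow> (nat \<Rightarrow> nat) \<Rightarrow> (nat \<Rightarrow> nat \<Rightarrow> 'x word) \<Rightarrow> (nat \<Rightarrow> nat \<Rightarrow> 'x word)
   \<Rightarrow> ('x + nat) word set" where
  "hnn_rels R n m u v = base_word ` R \<union>
     {[(Inr i, False)] @ base_word (u i j) @ [(Inr i, True)] @ word_inv (base_word (v i j)) | i j.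
        i \<in> {1..n} \<and> j \<in> {1..m i}}"

text \<open>The data of a multiple HNN extension of \<open>A = \<langle>X | R\<rangle>\<close> with finitely generated associated
  subgroups.\<close>

definition multiple_HNN ::
  "'x set \<Rightarrow> 'x word set \<Rightarrow> nat \<Rightarrow> (nat \<Rightarrow> 'x word set set) \<Rightarrow> (nat \<Rightarrow> 'x word set set)
   \<Rightarrow> (nat \<Rightarrow> 'x word set \<Rightarrow> 'x word set)
   \<Rightarrow> (nat \<Rightarrow> nat) \<Rightarrow> (nat \<Rightarrow> nat \<Rightarrow> 'x word) \<Rightarrow> (nat \<Rightarrow> nat \<Rightarrow> 'x word) \<Rightarrow> bool" where
  "multiple_HNN X R n U V \<phi> m u v \<longleftrightarrow>
     (let A = presented_group X R; val = word_val A (presented_gen X R) in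
      \<forall>i \<in> {1..n}.
        subgroup (U i) A \<and> subgroup (V i) A \<and>
        \<phi> i \<in> iso (A\<lparr>carrier := U i\<rparr>) (A\<lparr>carrier := V i\<rparr>) \<and>
        (\<forall>j \<in> {1..m i}. u i j \<in> words X \<and> v i j \<in> words X) \<and>
        U i = generate A ((\<lambda>j. val (u i j)) ` {1..m i}) \<and>
        (\<forall>j \<in> {1..m i}. val (v i j) = \<phi> i (val (u i j))))"

text \<open>\<open>expand f z\<close> reads a word \<open>z\<close> in the symbols \<open>j\<close>, each standing for the word \<open>f j\<close>, as a word
  over the original generators.\<close>

definition expand :: "(nat \<Rightarrow> 'x word) \<Rightarrow> nat word \<Rightarrow> 'x word" where
  "expand f z = concat (map (\<lambda>(j, e). if e then f j else word_inv (f j)) z)"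

text \<open>Free reducedness refers to the letters \<open>j\<close> rather than to the words \<open>f j\<close>.\<close>

definition geodesic_family ::
  "('g, 'm) monoid_scheme \<Rightarrow> ('x \<Rightarrow> 'g) \<Rightarrow> 'x set \<Rightarrow> nat \<Rightarrow> (nat \<Rightarrow> 'x word) \<Rightarrow> bool" where
  "geodesic_family A \<iota> X k f \<longleftrightarrow>
     (\<forall>z \<in> words {1..k}. freely_reduced z \<longrightarrow> geodesic_word A \<iota> X (expand f z))"

definition totally_geodesic_family ::
  "('g, 'm) monoid_scheme \<Rightarrow> ('x \<Rightarrow> 'g) \<Rightarrow> 'x set \<Rightarrow> 'g set \<Rightarrow> nat \<Rightarrow> (nat \<Rightarrow> 'x word) \<Rightarrow> bool" where
  "totally_geodesic_family A \<iota> X S k f \<longleftrightarrow>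
     geodesic_family A \<iota> X k f \<and>
     (\<forall>w. geodesic_word A \<iota> X w \<and> word_val A \<iota> w \<in> S \<longrightarrow> w \<in> expand f ` words {1..k})"

definition isometric_multiple_HNN ::
  "'x set \<Rightarrow> 'x word set \<Rightarrow> nat \<Rightarrow> (nat \<Rightarrow> 'x word set set) \<Rightarrow> (nat \<Rightarrow> 'x word set set)
   \<Rightarrow> (nat \<Rightarrow> 'x word set \<Rightarrow> 'x word set)
   \<Rightarrow> (nat \<Rightarrow> nat) \<Rightarrow> (nat \<Rightarrow> nat \<Rightarrow> 'x word) \<Rightarrow> (nat \<Rightarrow> nat \<Rightarrow> 'x word) \<Rightarrow> bool" where
  "isometric_multiple_HNN X R n U V \<phi> m u v \<longleftrightarrow>
     (let A = presented_group X R; \<iota> = presented_gen X R in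
      multiple_HNN X R n U V \<phi> m u v \<and>
      (\<forall>i \<in> {1..n}.
         free_group (A\<lparr>carrier := U i\<rparr>) \<and> free_group (A\<lparr>carrier := V i\<rparr>) \<and>
         totally_geodesic_family A \<iota> X (U i) (m i) (u i) \<and>
         totally_geodesic_family A \<iota> X (V i) (m i) (v i) \<and>
         (\<forall>j \<in> {1..m i}. length (u i j) = length (v i j))))"


section \<open>Presented groups are groups\<close>

lemma words_Nil [simp]: "[] \<in> words X"
  and words_Cons [simp]: "a # w \<in> words X \<longleftrightarrow> fst a \<in> X \<and> w \<in> words X"
  and words_append [simp]: "w @ w' \<in> words X \<longleftrightarrow> w \<in> words X \<and> w' \<in> words X"
  by (cases a; auto simp: words_def)+

lemma word_inv_in_words [simp]: "word_inv w \<in> words X \<longleftrightarrow> w \<in> words X"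
  by (induction w) (auto simp: word_inv_def letter_inv_def)

lemma pres_rel_words: "(w, w') \<in> pres_rel X R \<Longrightarrow> w \<in> words X \<and> w' \<in> words X"
  by (induction rule: pres_rel.induct) (auto simp: letter_inv_def)

lemma equiv_pres_rel: "equiv (words X) (pres_rel X R)"
  by (rule equivI)
    (auto simp: refl_on_def sym_def trans_def dest: pres_rel_words intro: pres_rel.intros)

lemma pres_rel_context:
  assumes "(w, w') \<in> pres_rel X R" "p \<in> words X" "q \<in> words X"
  shows "(p @ w @ q, p @ w' @ q) \<in> pres_rel X R"
  using assms
proof (induction rule: pres_rel.induct)
  case (cancel p' q' a)
  then show ?case using pres_rel.cancel[of "p @ p'" X "q' @ q" a R] by simp
next
  case (relator p' q' r)
  then show ?case using pres_rel.relator[of "p @ p'" X "q' @ q" r R] by simp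
qed (auto intro: pres_rel.intros)

lemma pres_rel_append:
  assumes "(w, w') \<in> pres_rel X R" "(z, z') \<in> pres_rel X R"
  shows "(w @ z, w' @ z') \<in> pres_rel X R"
proof -
  have "(w @ z, w' @ z) \<in> pres_rel X R"
    using pres_rel_context[OF assms(1), of "[]" z] assms(2) by (auto dest: pres_rel_words)
  moreover have "(w' @ z, w' @ z') \<in> pres_rel X R"
    using pres_rel_context[OF assms(2), of w' "[]"] assms(1) by (auto dest: pres_rel_words)
  ultimately show ?thesis by (rule pres_rel.trans)
qed

lemma presented_mult:
  assumes "w \<in> words X" "z \<in> words X"
  shows "(pres_rel X R `` {w}) \<otimes>\<^bsub>presented_group X R\<^esub> (pres_rel X R `` {z}) = pres_rel X R `` {w @ z}"
proof -
  have "congruent2 (pres_rel X R) (pres_rel X R) (\<lambda>p q. pres_rel X R `` {p @ q})"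
    by (auto simp: congruent2_def intro!: equiv_class_eq[OF equiv_pres_rel] pres_rel_append)
  from UN_equiv_class2[OF equiv_pres_rel equiv_pres_rel this assms]
  show ?thesis by (simp add: presented_group_def)
qed

lemma pres_rel_word_inv:
  assumes "w \<in> words X"
  shows "(word_inv w @ w, []) \<in> pres_rel X R"
  using assms
proof (induction w)
  case Nil
  then show ?case by (auto simp: word_inv_def intro: pres_rel.refl)
next
  case (Cons a w)
  have "letter_inv (letter_inv a) = a" by (simp add: letter_inv_def)
  then have "(word_inv w @ [letter_inv a, a] @ w, word_inv w @ w) \<in> pres_rel X R"
    using pres_rel.cancel[of "word_inv w" X w "letter_inv a" R] Cons.prems
    by (simp add: letter_inv_def)
  then show ?case
    using Cons by (auto simp: word_inv_def intro: pres_rel.trans)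
qed

lemma carrier_presented_group:
  "carrier (presented_group X R) = (\<lambda>w. pres_rel X R `` {w}) ` words X"
  by (auto simp: presented_group_def quotient_def)

lemma one_presented_group: "\<one>\<^bsub>presented_group X R\<^esub> = pres_rel X R `` {[]}"
  by (simp add: presented_group_def)

lemma group_presented_group: "group (presented_group X R)"
proof (rule groupI)
  fix P assume "P \<in> carrier (presented_group X R)"
  then obtain p where p: "p \<in> words X" "P = pres_rel X R `` {p}"
    by (auto simp: carrier_presented_group)
  have "pres_rel X R `` {word_inv p} \<otimes>\<^bsub>presented_group X R\<^esub> P = \<one>\<^bsub>presented_group X R\<^esub>"
    using p pres_rel_word_inv[OF p(1)]
    by (simp add: presented_mult one_presented_group equiv_class_eq[OF equiv_pres_rel])
  then show "\<exists>Q\<in>carrier (presented_group X R). Q \<otimes>\<^bsub>presented_group X R\<^esub> P = \<one>\<^bsub>presented_group X R\<^esub>"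
    using p by (auto simp: carrier_presented_group)
qed (auto simp: carrier_presented_group one_presented_group presented_mult)

lemma word_val_presented_group:
  assumes "w \<in> words X"
  shows "word_val (presented_group X R) (presented_gen X R) w = pres_rel X R `` {w}"
  using assms
proof (induction w)
  case Nil
  then show ?case by (simp add: one_presented_group)
next
  case (Cons a w)
  obtain x e where a: "a = (x, e)" by (cases a)
  have x: "x \<in> X" using Cons.prems a by simp
  interpret group "presented_group X R" by (rule group_presented_group)
  have "pres_rel X R `` {[(x, False)]} \<otimes>\<^bsub>presented_group X R\<^esub> presented_gen X R x
      = \<one>\<^bsub>presented_group X R\<^esub>"
    using x pres_rel_word_inv[of "[(x, True)]" X R]
    by (simp add: presented_gen_def presented_mult one_presented_group word_inv_def letter_inv_def
        equiv_class_eq[OF equiv_pres_rel])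
  then have "inv\<^bsub>presented_group X R\<^esub> (presented_gen X R x) = pres_rel X R `` {[(x, False)]}"
    using x by (intro inv_equality) (auto simp: carrier_presented_group presented_gen_def)
  then show ?case
    using Cons x a by (cases e) (auto simp: presented_mult presented_gen_def)
qed

end

theory Submission
  imports Defs
begin

text \<open>Let \<open>g\<close>, \<open>g'\<close> lie on the sphere of radius \<open>N\<close> at distance at most 2. Britton's lemma pairs the last
  stable letters of geodesics \<open>p s a\<close> for \<open>g\<close> and \<open>p' s a'\<close> for \<open>g'\<close>: the word \<open>W = a \<gamma> a'\<inverse>\<close> over \<open>X\<close>
  that joins the two points \<open>p s\<close> and \<open>p' s\<close> through \<open>g\<close> and \<open>g'\<close> represents an element of an associated
  subgroup. The level of
  a vertex on \<open>W\<close> is bounded through its distance to either end, and these bounds keep \<open>W\<close> in the ball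
  except for an excess of at most 2 in its length. If \<open>W\<close> is not geodesic in the base group, a shorter
  fellow traveler reduces the excess. If it is geodesic, total geodesicity makes \<open>W\<close> one side of a strip
  whose other side, from \<open>p\<close> to \<open>p'\<close>, has the same length but starts and ends one step closer to the
  identity, and hence stays in the ball. At most two reductions are needed, so the detour has bounded
  length.\<close>

section \<open>Levels and paths in the Cayley graph\<close>

text \<open>Britton's lemma is to be applied to geodesics, so these must have no pinch. A pinch
  shortens a word by two letters: its middle segment may be taken geodesic, is then a product of the
  given generators, and can be traded for the equally long word on the other side of a strip. The
  lemma itself comes from letting words act on normal forms, so that equal elements have equal
  states. The excess 2 is matched exactly by a strip, whose far side saves one stable edge at either
  end. The obstacle is that neither detour starts at an arbitrary vertex: a strip can be crossed
  only between two generators, and a jump to a fellow traveler is safe only \<open>K\<close> below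
  the sphere. Both ends therefore first retreat along \<open>W\<close>, at a cost governed by
  \<open>K\<close> and by the length \<open>M\<close> of the longest generator. A path from
  \<open>g\<close> to \<open>g'\<close> may also use stable letters. Such an edge never joins two
  vertices of one sphere. Over a vertex of level \<open>N + 1\<close> it meets either another stable
  edge, and then \<open>g = g'\<close>, or a base edge, and then a strip is available at
  once.\<close>

lemma word_inv_Nil [simp]: "word_inv [] = []"
  and word_inv_Cons: "word_inv (a # w) = word_inv w @ [letter_inv a]"
  and length_word_inv [simp]: "length (word_inv w) = length w"
  by (simp_all add: word_inv_def)

lemma words_take [simp]: "w \<in> words S \<Longrightarrow> take i w \<in> words S"
  and words_drop [simp]: "w \<in> words S \<Longrightarrow> drop i w \<in> words S"
  by (auto simp: words_def dest: in_set_takeD in_set_dropD)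

lemma words_nth: "w \<in> words S \<Longrightarrow> i < length w \<Longrightarrow> fst (w ! i) \<in> S"
  by (metis lists_def in_listsD mem_Sigma_iff nth_mem prod.collapse words_def)

text \<open>Used both for the base group and for the extension. By \<open>word_surj\<close> the set
  under \<open>LEAST\<close> in \<open>vertex_dist\<close> is never empty, so every distance is
  attained by a word.\<close>

locale generated_group = group G for G (structure) +
  fixes \<iota> :: "'x \<Rightarrow> 'a" and S :: "'x set"
  assumes gen_closed: "x \<in> S \<Longrightarrow> \<iota> x \<in> carrier G"
    and word_surj: "g \<in> carrier G \<Longrightarrow> \<exists>w\<in>words S. word_val G \<iota> w = g"
begin

abbreviation val :: "'x word \<Rightarrow> 'a" where
  "val \<equiv> word_val G \<iota>"

abbreviation gdist :: "'a \<Rightarrow> 'a \<Rightarrow> nat" where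
  "gdist \<equiv> vertex_dist G \<iota> S"

abbreviation lev :: "'a \<Rightarrow> nat" where
  "lev \<equiv> gdist \<one>"

lemma val_closed [simp]: "w \<in> words S \<Longrightarrow> val w \<in> carrier G"
  by (induction w) (auto simp: gen_closed)

lemma val_append:
  "w \<in> words S \<Longrightarrow> w' \<in> words S \<Longrightarrow> val (w @ w') = val w \<otimes> val w'"
  by (induction w) (auto simp: gen_closed m_assoc)

lemma val_letter_inv: "fst a \<in> S \<Longrightarrow> val [letter_inv a] = inv (val [a])"
  by (cases a) (auto simp: letter_inv_def gen_closed)

lemma val_word_inv: "w \<in> words S \<Longrightarrow> val (word_inv w) = inv (val w)"
proof (induction w)
  case (Cons a w)
  have "val (word_inv (a # w)) = inv (val w) \<otimes> inv (val [a])"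
    using Cons by (subst word_inv_Cons, subst val_append)
      (auto simp: val_letter_inv simp del: word_val.simps, simp add: letter_inv_def)
  also have "\<dots> = inv (val ([a] @ w))"
    using Cons.prems by (subst val_append) (auto simp: inv_mult_group simp del: word_val.simps append_Cons append_Nil)
  finally show ?case by simp
qed auto

lemma gdist_witness:
  assumes "g \<in> carrier G" "h \<in> carrier G"
  obtains w where "w \<in> words S" "length w = gdist g h" "g \<otimes> val w = h"
proof -
  obtain w where w: "w \<in> words S" "val w = inv g \<otimes> h"
    using word_surj[of "inv g \<otimes> h"] assms by auto
  have "g \<otimes> val w = h"
    using assms w by (simp add: m_assoc[symmetric])
  with w(1) have "\<exists>l. \<exists>w\<in>words S. length w = l \<and> g \<otimes> val w = h"
    by blast
  from LeastI_ex[OF this] show ?thesis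
    using that by (auto simp: vertex_dist_def)
qed

lemma gdist_le: "w \<in> words S \<Longrightarrow> g \<otimes> val w = h \<Longrightarrow> gdist g h \<le> length w"
  unfolding vertex_dist_def by (rule Least_le) auto

lemma gdist_triangle:
  assumes "g \<in> carrier G" "h \<in> carrier G" "k \<in> carrier G"
  shows "gdist g k \<le> gdist g h + gdist h k"
proof -
  obtain w where w: "w \<in> words S" "length w = gdist g h" "g \<otimes> val w = h"
    using gdist_witness assms by blast
  obtain z where z: "z \<in> words S" "length z = gdist h k" "h \<otimes> val z = k"
    using gdist_witness assms by blast
  have "g \<otimes> val (w @ z) = k"
    using w z assms by (auto simp: val_append m_assoc)
  from gdist_le[OF _ this] show ?thesis using w z by simp
qed

lemma gdist_sym_le:
  assumes "g \<in> carrier G" "h \<in> carrier G"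
  shows "gdist g h \<le> gdist h g"
proof -
  obtain w where w: "w \<in> words S" "length w = gdist h g" "h \<otimes> val w = g"
    using gdist_witness assms by blast
  have "g \<otimes> val (word_inv w) = h"
    using w assms by (auto simp: val_word_inv m_assoc)
  from gdist_le[OF _ this] show ?thesis using w by simp
qed

lemma lev_val: "w \<in> words S \<Longrightarrow> lev (val w) \<le> length w"
  by (rule gdist_le) auto

lemma lev_mult:
  assumes "g \<in> carrier G" "w \<in> words S"
  shows "lev (g \<otimes> val w) \<le> lev g + length w"
proof -
  have "gdist g (g \<otimes> val w) \<le> length w" using assms by (intro gdist_le) auto
  then show ?thesis using gdist_triangle[of \<one> g "g \<otimes> val w"] assms by simp
qed

lemma lev_mult_back:
  assumes "g \<in> carrier G" "w \<in> words S"
  shows "lev g \<le> lev (g \<otimes> val w) + length w"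
  using lev_mult[of "g \<otimes> val w" "word_inv w"] assms by (simp add: val_word_inv m_assoc)

lemma lev_witness:
  assumes "g \<in> carrier G"
  obtains w where "w \<in> words S" "length w = lev g" "val w = g"
  using gdist_witness[of \<one> g] assms by (metis l_one one_closed val_closed)

lemma val_take_Suc:
  assumes "w \<in> words S" "i < length w"
  shows "val (take (Suc i) w) = val (take i w) \<otimes> val [w ! i]"
proof -
  have "fst (w ! i) \<in> S" using assms by (rule words_nth)
  then have "val (take i w @ [w ! i]) = val (take i w) \<otimes> val [w ! i]"
    using assms by (intro val_append) auto
  then show ?thesis using assms by (simp add: take_Suc_conv_app_nth)
qed

text \<open>An edge lies in the ball of radius \<open>N\<close> iff the levels of its ends have sum less than \<open>2 * N\<close>:
  the levels differ by at most 1, and the midpoint of an edge joining two vertices of the sphere is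
  outside the ball.\<close>

definition inner :: "nat \<Rightarrow> ('a \<times> 'a) set" where
  "inner N = {(g, h). g \<in> carrier G \<and> (\<exists>a. fst a \<in> S \<and> h = g \<otimes> val [a]) \<and> lev g + lev h < 2 * N}"

definition conn :: "nat \<Rightarrow> nat \<Rightarrow> 'a \<Rightarrow> 'a \<Rightarrow> bool" where
  "conn N C g h \<longleftrightarrow> (\<exists>k\<le>C. (g, h) \<in> inner N ^^ k)"

lemma inner_sym: "(g, h) \<in> inner N \<Longrightarrow> (h, g) \<in> inner N"
proof -
  assume "(g, h) \<in> inner N"
  then obtain a where a: "g \<in> carrier G" "fst a \<in> S" "h = g \<otimes> val [a]" "lev g + lev h < 2 * N"
    by (auto simp: inner_def)
  have c: "val [a] \<in> carrier G" using a by (intro val_closed) auto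
  have "g = h \<otimes> val [letter_inv a]"
    using a c by (simp add: val_letter_inv m_assoc del: word_val.simps)
  moreover have "fst (letter_inv a) \<in> S" using a by (simp add: letter_inv_def)
  moreover have "h \<in> carrier G" using a c by simp
  moreover have "lev h + lev g < 2 * N" using a by simp
  ultimately show ?thesis unfolding inner_def by blast
qed

lemma conn_refl [simp]: "conn N C g g"
  by (auto simp: conn_def intro!: exI[of _ 0])

lemma conn_mono: "conn N C g h \<Longrightarrow> C \<le> C' \<Longrightarrow> conn N C' g h"
  by (auto simp: conn_def intro: order_trans)

lemma conn_trans: "conn N C g h \<Longrightarrow> conn N C' h k \<Longrightarrow> conn N (C + C') g k"
  unfolding conn_def by (metis add_mono relpow_trans)

lemma conn_sym: "conn N C g h \<Longrightarrow> conn N C h g"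
proof -
  have "(g, h) \<in> inner N ^^ k \<Longrightarrow> (h, g) \<in> inner N ^^ k" for k g h
  proof (induction k arbitrary: h)
    case (Suc k)
    then show ?case by (meson inner_sym relpow_Suc_E relpow_Suc_I2)
  qed auto
  then show "conn N C g h \<Longrightarrow> conn N C h g" unfolding conn_def by blast
qed

lemma conn_edge:
  assumes "g \<in> carrier G" "fst a \<in> S" "lev g + lev (g \<otimes> val [a]) < 2 * N"
  shows "conn N 1 g (g \<otimes> val [a])"
proof -
  have "(g, g \<otimes> val [a]) \<in> inner N" using assms unfolding inner_def by blast
  then show ?thesis unfolding conn_def by (intro exI[of _ 1]) auto
qed

text \<open>The vertex after \<open>q\<close> letters of \<open>Y\<close> has level at most \<open>a + q\<close> and at most \<open>b + length Y - q\<close>.\<close>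

lemma conn_corridor:
  assumes p: "p \<in> carrier G" "lev p \<le> a" and b: "lev (p \<otimes> val Y) \<le> b"
    and Y: "Y \<in> words S" "a + b + length Y \<le> 2 * N" and ij: "i \<le> j" "j \<le> length Y"
  shows "conn N (j - i) (p \<otimes> val (take i Y)) (p \<otimes> val (take j Y))"
  using ij
proof (induction j rule: dec_induct)
  case (step j)
  let ?g = "p \<otimes> val (take j Y)" and ?h = "p \<otimes> val (take (Suc j) Y)"
  have x: "fst (Y ! j) \<in> S" using Y step by (intro words_nth) auto
  then have vx: "val [Y ! j] \<in> carrier G" by (intro val_closed) simp
  have h: "?h = ?g \<otimes> val [Y ! j]"
    using step Y p vx by (simp add: val_take_Suc m_assoc del: word_val.simps)
  have l1: "lev ?g \<le> a + j"
    using lev_mult[of p "take j Y"] p Y step by auto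
  have "val Y = val (take (Suc j) Y) \<otimes> val (drop (Suc j) Y)"
    using Y val_append[of "take (Suc j) Y" "drop (Suc j) Y"] by simp
  then have "p \<otimes> val Y = ?h \<otimes> val (drop (Suc j) Y)"
    using Y p by (simp add: m_assoc)
  then have "lev ?h \<le> b + (length Y - Suc j)"
    using lev_mult_back[of ?h "drop (Suc j) Y"] p Y b by simp
  \<comment> \<open>The two bounds are taken one letter apart, so they add up to
    \<open>a + b + length Y - 1\<close>; this is what makes the inequality strict.\<close>
  with l1 have "lev ?g + lev ?h < 2 * N"
    using Y step by simp
  then have "conn N 1 ?g ?h"
    unfolding h using p Y x by (intro conn_edge) auto
  from conn_trans[OF step.IH[OF Suc_leD[OF step.prems]] this] show ?case
    using step by (simp add: Suc_diff_le)
qed auto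

text \<open>The corridor for the initial segment \<open>take j Y\<close>, whose end has level at
  most \<open>a + j\<close>: the climb from \<open>p\<close> alone gives both bounds.\<close>

lemma conn_up:
  assumes "p \<in> carrier G" "lev p \<le> a" "Y \<in> words S" "a + j \<le> N" "i \<le> j" "j \<le> length Y"
  shows "conn N (j - i) (p \<otimes> val (take i Y)) (p \<otimes> val (take j Y))"
  using conn_corridor[of p a "take j Y" "a + j" N i j] lev_mult[of p "take j Y"] assms
  by (simp add: min_absorb1 min_absorb2)

text \<open>Mirror image of \<open>conn_up\<close>: levels are estimated from the far end of
  \<open>Y\<close>, and the corridor runs along \<open>drop i Y\<close>.\<close>

lemma conn_down:
  assumes p: "p \<in> carrier G" and lev: "lev (p \<otimes> val Y) \<le> b" and Y: "Y \<in> words S"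
    and "b + length Y \<le> N + i" "i \<le> j" "j \<le> length Y"
  shows "conn N (j - i) (p \<otimes> val (take i Y)) (p \<otimes> val (take j Y))"
proof -
  let ?p = "p \<otimes> val (take i Y)"
  have split: "p \<otimes> val (take l Y) = ?p \<otimes> val (take (l - i) (drop i Y))" if "i \<le> l" for l
  proof -
    have "take l Y = take i Y @ take (l - i) (drop i Y)"
      using that by (metis le_add_diff_inverse take_add)
    then show ?thesis using p Y by (simp add: val_append m_assoc)
  qed
  have end_eq: "p \<otimes> val Y = ?p \<otimes> val (drop i Y)" using split[of "length Y"] assms by simp
  have "lev ?p \<le> b + (length Y - i)"
    using lev_mult_back[of ?p "drop i Y"] p Y lev end_eq by simp
  then show ?thesis
    using conn_corridor[of ?p "b + (length Y - i)" "drop i Y" b N 0 "j - i"] assms split[of j] end_eq by simp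
qed

text \<open>A path that starts \<open>length c\<close> below the sphere is too short to leave the
  ball, wherever it goes. This serves for jumps between fellow travelers, about whose route nothing
  is known.\<close>

lemma conn_free_path:
  assumes "g \<in> carrier G" "c \<in> words S" "lev g + length c \<le> N"
  shows "conn N (length c) g (g \<otimes> val c)"
  using conn_corridor[of g "lev g" c "lev g + length c" N 0 "length c"] lev_mult[of g c] assms by simp

lemma conn_free_path_le:
  assumes "g \<in> carrier G" "h \<in> carrier G" "gdist g h \<le> K" "lev g + K \<le> N"
  shows "conn N K g h"
proof -
  obtain c where c: "c \<in> words S" "length c = gdist g h" "g \<otimes> val c = h"
    using gdist_witness assms by blast
  then show ?thesis using conn_free_path[of g c N] assms conn_mono by fastforce
qed

section \<open>Fellow traveling: from points of the Cayley graph to vertices\<close>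

lemma exits_finite [simp]: "finite (exits G \<iota> p)" "exits G \<iota> p \<noteq> {}"
  by (cases p; simp)+

lemma dist_via_vertices_witness:
  obtains h r h' s where "(h, r) \<in> exits G \<iota> p" "(h', s) \<in> exits G \<iota> q"
    "dist_via_vertices G \<iota> S p q = r + real (gdist h h') + s"
proof -
  have "dist_via_vertices G \<iota> S p q \<in>
      (\<lambda>((g, r), (h, s)). r + real (gdist g h) + s) ` (exits G \<iota> p \<times> exits G \<iota> q)"
    unfolding dist_via_vertices_def by (rule Min_in) auto
  then show ?thesis using that by auto
qed

text \<open>At an integer time before the end, a path point is still coded as an
  \<open>Edge_Point\<close> with parameter 0 or 1. An exit may thus be the other end of that edge,
  which accounts for the 1.\<close>

lemma path_point_exit:
  assumes w: "w \<in> words S" and e: "(h, r) \<in> exits G \<iota> (path_point G \<iota> \<one> w (real i))"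
  shows "h \<in> carrier G \<and> r \<ge> 0 \<and> gdist (val (take i w)) h \<le> 1"
proof (cases "i \<ge> length w")
  case True
  then have "h = val w" "r = 0" using e w by (auto simp: path_point_def)
  then show ?thesis using w True gdist_le[of "[]" "val w" "val w"] by auto
next
  case False
  let ?g = "val (take i w)" and ?x = "fst (w ! i)"
  have g: "?g \<in> carrier G" and x: "?x \<in> S" using w False by (auto intro: words_nth)
  have ix: "\<iota> ?x \<in> carrier G" using x by (rule gen_closed)
  have 0: "gdist ?g ?g \<le> 1" using gdist_le[of "[]" ?g ?g] g by auto
  have 1: "gdist ?g (?g \<otimes> \<iota> ?x) \<le> 1"
    using gdist_le[of "[(?x, True)]" ?g] g x ix by auto
  have 2: "gdist ?g (?g \<otimes> inv (\<iota> ?x)) \<le> 1"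
    using gdist_le[of "[(?x, False)]" ?g] g x ix by auto
  have 3: "?g \<otimes> inv (\<iota> ?x) \<otimes> \<iota> ?x = ?g" using g ix by (simp add: m_assoc)
  show ?thesis
    using e False g ix 0 1 2 3 by (auto simp: path_point_def Let_def split: if_splits)
qed

text \<open>The 2 pays for one step to an exit on either side, and the exits are at most
  \<open>k\<close> apart. If the bound \<open>k\<close> is achieved only inside a common edge, an
  endpoint of that edge serves as exit for both points.\<close>

lemma gdist_path_points:
  assumes w: "w \<in> words S" and u: "u \<in> words S" and "k > 0"
    and d: "cayley_dist G \<iota> S (path_point G \<iota> \<one> w (real i)) (path_point G \<iota> \<one> u (real i)) \<le> k"
  shows "gdist (val (take i w)) (val (take i u)) \<le> 2 + nat \<lceil>k\<rceil>"
proof -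
  let ?p = "path_point G \<iota> \<one> w (real i)" and ?q = "path_point G \<iota> \<one> u (real i)"
  obtain h r h' s where 1: "(h, r) \<in> exits G \<iota> ?p" "(h', s) \<in> exits G \<iota> ?q"
      and 2: "dist_via_vertices G \<iota> S ?p ?q = r + real (gdist h h') + s"
    using dist_via_vertices_witness by blast
  have "\<exists>h h' r s. (h, r) \<in> exits G \<iota> ?p \<and> (h', s) \<in> exits G \<iota> ?q \<and> real (gdist h h') \<le> k"
  proof (cases "dist_via_vertices G \<iota> S ?p ?q \<le> k")
    case True
    with 1 2 path_point_exit[OF w 1(1)] path_point_exit[OF u 1(2)]
    have "real (gdist h h') \<le> k" by linarith
    with 1 show ?thesis by blast
  next
    case False
    then obtain g x r s where pq: "?p = Edge_Point g x r" "?q = Edge_Point g x s"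
      using d by (cases ?p; cases ?q; auto split: if_splits)
    then have e: "(g, r) \<in> exits G \<iota> ?p" "(g, s) \<in> exits G \<iota> ?q" by auto
    then have "g \<in> carrier G" using path_point_exit[OF w] by blast
    then have "real (gdist g g) \<le> k" using gdist_le[of "[]" g g] \<open>k > 0\<close> by auto
    with e show ?thesis by blast
  qed
  then obtain h h' r s where e: "(h, r) \<in> exits G \<iota> ?p" "(h', s) \<in> exits G \<iota> ?q"
    and le: "real (gdist h h') \<le> k" by blast
  have "gdist h h' \<le> nat \<lceil>k\<rceil>" using le by linarith
  moreover have h: "h \<in> carrier G" "gdist (val (take i w)) h \<le> 1"
    using path_point_exit[OF w e(1)] by auto
  moreover have h': "h' \<in> carrier G" "gdist (val (take i u)) h' \<le> 1"
    using path_point_exit[OF u e(2)] by auto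
  moreover have "gdist h' (val (take i u)) \<le> 1"
    using gdist_sym_le[of h' "val (take i u)"] h' u by simp
  moreover have "gdist (val (take i w)) (val (take i u))
      \<le> gdist (val (take i w)) h + gdist h (val (take i u))"
    using h h' w u by (intro gdist_triangle) auto
  moreover have "gdist h (val (take i u)) \<le> gdist h h' + gdist h' (val (take i u))"
    using h h' w u by (intro gdist_triangle) auto
  ultimately show ?thesis by linarith
qed

definition vertex_fellow_traveler :: "nat \<Rightarrow> bool" where
  "vertex_fellow_traveler K \<longleftrightarrow> (\<forall>w\<in>words S. \<not> geodesic_word G \<iota> S w \<longrightarrow>
     (\<exists>u\<in>words S. length u < length w \<and> val u = val w \<and>
       (\<forall>i. gdist (val (take i w)) (val (take i u)) \<le> K)))"

lemma ex_vertex_fellow_traveler: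
  assumes "falsification_by_fellow_traveler G \<iota> S"
  shows "\<exists>K. vertex_fellow_traveler K"
proof -
  obtain k :: real where "k > 0" and k: "\<And>w. w \<in> words S \<Longrightarrow> \<not> geodesic_word G \<iota> S w \<Longrightarrow>
      \<exists>u\<in>words S. length u < length w \<and> val u = val w \<and>
        (\<forall>t\<ge>0. cayley_dist G \<iota> S (path_point G \<iota> \<one> w t) (path_point G \<iota> \<one> u t) \<le> k)"
    using assms unfolding falsification_by_fellow_traveler_def by blast
  have "vertex_fellow_traveler (2 + nat \<lceil>k\<rceil>)"
    unfolding vertex_fellow_traveler_def
  proof (intro ballI impI)
    fix w assume w: "w \<in> words S" "\<not> geodesic_word G \<iota> S w"
    from k[OF w] obtain u where u: "u \<in> words S" "length u < length w" "val u = val w"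
      and t: "\<And>t. t \<ge> 0 \<Longrightarrow> cayley_dist G \<iota> S (path_point G \<iota> \<one> w t) (path_point G \<iota> \<one> u t) \<le> k"
      by blast
    have "gdist (val (take i w)) (val (take i u)) \<le> 2 + nat \<lceil>k\<rceil>" for i
      using gdist_path_points[OF w(1) u(1) \<open>k > 0\<close> t] by simp
    with u show "\<exists>u\<in>words S. length u < length w \<and> val u = val w \<and>
        (\<forall>i. gdist (val (take i w)) (val (take i u)) \<le> 2 + nat \<lceil>k\<rceil>)" by blast
  qed
  then show ?thesis ..
qed

section \<open>From chains of inner edges back to paths in the metric ball\<close>

lemma inner_relpow_word:
  "(g, h) \<in> inner N ^^ k \<Longrightarrow> g \<in> carrier G \<Longrightarrow>
     \<exists>w\<in>words S. length w = k \<and> g \<otimes> val w = h \<and>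
       (\<forall>i<k. lev (g \<otimes> val (take i w)) + lev (g \<otimes> val (take (Suc i) w)) < 2 * N)"
proof (induction k arbitrary: h)
  case (Suc k)
  then obtain h' where h': "(g, h') \<in> inner N ^^ k" "(h', h) \<in> inner N" by auto
  then obtain w where w: "w \<in> words S" "length w = k" "g \<otimes> val w = h'"
      "\<forall>i<k. lev (g \<otimes> val (take i w)) + lev (g \<otimes> val (take (Suc i) w)) < 2 * N"
    using Suc by blast
  obtain a where a: "fst a \<in> S" "h = h' \<otimes> val [a]" "lev h' + lev h < 2 * N"
    using h' by (auto simp: inner_def simp del: word_val.simps)
  have "g \<otimes> val (w @ [a]) = h"
    using w a Suc.prems by (subst val_append) (auto simp: m_assoc[symmetric] simp del: word_val.simps)
  then show ?case
    using w a by (intro bexI[of _ "w @ [a]"]) (auto simp: less_Suc_eq simp del: word_val.simps)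
qed auto

lemma lev_path_point:
  assumes g: "g \<in> carrier G" and w: "w \<in> words S" and t: "0 \<le> t" "t < real (length w)"
    and lev: "lev (g \<otimes> val (take (nat \<lfloor>t\<rfloor>) w)) + lev (g \<otimes> val (take (Suc (nat \<lfloor>t\<rfloor>)) w)) < 2 * N"
  shows "cayley_dist G \<iota> S (Vertex \<one>) (path_point G \<iota> g w t) \<le> real N"
proof -
  define j where "j = nat \<lfloor>t\<rfloor>"
  define r where "r = t - real j"
  have j: "j < length w" using t by (simp add: j_def) linarith
  have r: "0 \<le> r" "r \<le> 1" using t by (simp_all add: r_def j_def) linarith+
  let ?h = "g \<otimes> val (take j w)" and ?x = "fst (w ! j)"
  have h: "?h \<in> carrier G" and x: "?x \<in> S" using g w j by (auto intro: words_nth)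
  have ix: "\<iota> ?x \<in> carrier G" using x by (rule gen_closed)
  have S: "g \<otimes> val (take (Suc j) w) = ?h \<otimes> val [w ! j]"
  proof -
    have "val [w ! j] \<in> carrier G" using x by (intro val_closed) simp
    then show ?thesis using g w j by (simp add: val_take_Suc m_assoc del: word_val.simps)
  qed
  let ?l = "real (lev ?h)" and ?l' = "real (lev (?h \<otimes> val [w ! j]))"
  have "lev ?h + lev (?h \<otimes> val [w ! j]) + 1 \<le> 2 * N"
    using lev unfolding j_def[symmetric] S by linarith
  then have sum: "?l + ?l' + 1 \<le> 2 * real N" by linarith
  \<comment> \<open>The mean of the two arguments is \<open>(?l + ?l' + 1) / 2\<close>,
    independently of \<open>r\<close>, and the smaller one does not exceed it.\<close>
  have m: "min (?l + r) (?l' + (1 - r)) \<le> real N" using sum by linarith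
  show ?thesis
  proof (cases "snd (w ! j)")
    case True
    then have "val [w ! j] = \<iota> ?x" using ix by (cases "w ! j") auto
    with True m j t show ?thesis
      by (simp add: path_point_def Let_def j_def[symmetric] r_def[symmetric] dist_via_vertices_def)
  next
    case False
    then have v: "val [w ! j] = inv (\<iota> ?x)" using ix by (cases "w ! j") auto
    have "?h \<otimes> inv (\<iota> ?x) \<otimes> \<iota> ?x = ?h" using h ix by (simp add: m_assoc)
    with v False m j t show ?thesis
      by (simp add: path_point_def Let_def j_def[symmetric] r_def[symmetric] dist_via_vertices_def)
  qed
qed

lemma almost_convexI:
  assumes conn: "\<And>N g g'. g \<in> carrier G \<Longrightarrow> g' \<in> carrier G \<Longrightarrow> lev g = N \<Longrightarrow> lev g' = N \<Longrightarrow>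
    gdist g g' \<le> 2 \<Longrightarrow> conn N C g g'"
  shows "almost_convex G \<iota> S"
  unfolding almost_convex_def
\<comment> \<open>The \<open>+ 1\<close> only provides positivity, since \<open>C\<close> may be
  0.\<close>
proof (intro exI[of _ "real C + 1"] conjI allI ballI impI)
  fix N g g'
  assume g: "g \<in> carrier G" "g' \<in> carrier G"
    and l: "lev g = N \<and> lev g' = N \<and> gdist g g' \<le> 2"
  then obtain k where k: "k \<le> C" "(g, g') \<in> inner N ^^ k"
    using conn[of g g' N] unfolding conn_def by blast
  from inner_relpow_word[OF k(2) g(1)] obtain w where w: "w \<in> words S" "length w = k" "g \<otimes> val w = g'"
    and i: "\<And>i. i < k \<Longrightarrow> lev (g \<otimes> val (take i w)) + lev (g \<otimes> val (take (Suc i) w)) < 2 * N"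
    by blast
  have "cayley_dist G \<iota> S (Vertex \<one>) (path_point G \<iota> g w t) \<le> real N" if "t \<in> {0..real (length w)}" for t
  proof (cases "t < real (length w)")
    case True
    then have "nat \<lfloor>t\<rfloor> < k" using that w by simp linarith
    then show ?thesis using lev_path_point[OF g(1) w(1) _ True i] that by simp
  next
    case False
    then have "path_point G \<iota> g w t = Vertex g'" using w by (simp add: path_point_def)
    then show ?thesis using l by (simp add: dist_via_vertices_def)
  qed
  with w k show "\<exists>w\<in>words S. g \<otimes> val w = g' \<and> real (length w) \<le> real C + 1 \<and>
      (\<forall>t\<in>{0..real (length w)}. cayley_dist G \<iota> S (Vertex \<one>) (path_point G \<iota> g w t) \<le> real N)"
    by (intro bexI[of _ w]) auto
qed simp

end

section \<open>Normal forms in HNN extensions\<close>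

text \<open>With \<open>e\<close> the sign of a stable letter, an element \<open>k\<close> of
  \<open>H i (\<not> e)\<close> standing before the letter passes behind it as
  \<open>\<theta> i (\<not> e) k\<close>. Indexing by the sign lets one argument cover an
  isomorphism and its inverse.\<close>

locale HNN_data = group A for A (structure) +
  fixes I :: "'i set" and H :: "'i \<Rightarrow> bool \<Rightarrow> 'a set" and \<theta> :: "'i \<Rightarrow> bool \<Rightarrow> 'a \<Rightarrow> 'a"
  assumes H_subgroup: "i \<in> I \<Longrightarrow> subgroup (H i e) A"
    and \<theta>_closed: "i \<in> I \<Longrightarrow> h \<in> H i e \<Longrightarrow> \<theta> i e h \<in> H i (\<not> e)"
    and \<theta>_mult: "i \<in> I \<Longrightarrow> h \<in> H i e \<Longrightarrow> h' \<in> H i e \<Longrightarrow> \<theta> i e (h \<otimes> h') = \<theta> i e h \<otimes> \<theta> i e h'"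
    and \<theta>_inverse: "i \<in> I \<Longrightarrow> h \<in> H i e \<Longrightarrow> \<theta> i (\<not> e) (\<theta> i e h) = h"
begin

lemma H_carrier: "i \<in> I \<Longrightarrow> h \<in> H i e \<Longrightarrow> h \<in> carrier A"
  using H_subgroup subgroup.mem_carrier by metis

lemma H_one [simp]: "i \<in> I \<Longrightarrow> \<one> \<in> H i e"
  using H_subgroup subgroup.one_closed by metis

lemma H_mult [simp]: "i \<in> I \<Longrightarrow> h \<in> H i e \<Longrightarrow> h' \<in> H i e \<Longrightarrow> h \<otimes> h' \<in> H i e"
  using H_subgroup subgroup.m_closed by metis

lemma H_inv [simp]: "i \<in> I \<Longrightarrow> h \<in> H i e \<Longrightarrow> inv h \<in> H i e"
  using H_subgroup subgroup.m_inv_closed by metis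

lemma H_mult_right_iff:
  assumes "i \<in> I" "h \<in> H i e" "x \<in> carrier A"
  shows "x \<otimes> h \<in> H i e \<longleftrightarrow> x \<in> H i e"
proof
  have "h \<in> carrier A" using H_carrier assms by blast
  moreover
  assume "x \<otimes> h \<in> H i e"
  then have "x \<otimes> h \<otimes> inv h \<in> H i e" using assms by (meson H_inv H_mult)
  ultimately show "x \<in> H i e" using assms by (simp add: m_assoc)
qed (use assms in auto)

lemma H_mult_left_iff:
  assumes "i \<in> I" "h \<in> H i e" "x \<in> carrier A"
  shows "h \<otimes> x \<in> H i e \<longleftrightarrow> x \<in> H i e"
proof
  have "h \<in> carrier A" using H_carrier assms by blast
  moreover
  assume "h \<otimes> x \<in> H i e"
  then have "inv h \<otimes> (h \<otimes> x) \<in> H i e" using assms by (meson H_inv H_mult)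
  ultimately show "x \<in> H i e" using assms by (simp add: m_assoc[symmetric])
qed (use assms in auto)

lemma \<theta>_closed': "i \<in> I \<Longrightarrow> h \<in> H i (\<not> e) \<Longrightarrow> \<theta> i (\<not> e) h \<in> H i e"
  using \<theta>_closed[of i h "\<not> e"] by simp

lemma \<theta>_inverse': "i \<in> I \<Longrightarrow> h \<in> H i (\<not> e) \<Longrightarrow> \<theta> i e (\<theta> i (\<not> e) h) = h"
  using \<theta>_inverse[of i h "\<not> e"] by simp

text \<open>A choice of representatives of the left cosets of \<open>H i e\<close>. The subgroup
  itself is represented by \<open>\<one>\<close>, so that for \<open>a\<close> in the carrier
  \<open>rep i e a = \<one>\<close> is a test for membership in it.\<close>

definition rep :: "'i \<Rightarrow> bool \<Rightarrow> 'a \<Rightarrow> 'a" where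
  "rep i e a = (if a \<in> H i e then \<one> else SOME r. r \<in> carrier A \<and> inv r \<otimes> a \<in> H i e)"

lemma rep_coset:
  assumes "i \<in> I" "a \<in> carrier A"
  shows "rep i e a \<in> carrier A \<and> inv (rep i e a) \<otimes> a \<in> H i e"
proof (cases "a \<in> H i e")
  case False
  have "\<exists>r. r \<in> carrier A \<and> inv r \<otimes> a \<in> H i e"
    using assms by (intro exI[of _ a]) auto
  from someI_ex[OF this] show ?thesis using False by (simp add: rep_def)
qed (use assms in \<open>auto simp: rep_def\<close>)

lemma rep_mult:
  assumes "i \<in> I" "a \<in> carrier A" "h \<in> H i e"
  shows "rep i e (a \<otimes> h) = rep i e a"
proof -
  \<comment> \<open>The predicates under \<open>SOME\<close> for \<open>a \<otimes> h\<close> and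
    for \<open>a\<close> are the same, hence so is the choice.\<close>
  have "(r \<in> carrier A \<and> inv r \<otimes> (a \<otimes> h) \<in> H i e) = (r \<in> carrier A \<and> inv r \<otimes> a \<in> H i e)" for r
    using H_mult_right_iff[of i h e "inv r \<otimes> a"] assms H_carrier[OF assms(1,3)] by (auto simp: m_assoc)
  then show ?thesis
    using H_mult_right_iff[OF assms(1,3,2)] by (simp add: rep_def)
qed

lemma rep_decomp: "i \<in> I \<Longrightarrow> a \<in> carrier A \<Longrightarrow> rep i e a \<otimes> (inv (rep i e a) \<otimes> a) = a"
  using rep_coset[of i a e] by (simp add: m_assoc[symmetric])

lemma rep_rep: "i \<in> I \<Longrightarrow> a \<in> carrier A \<Longrightarrow> rep i e (rep i e a) = rep i e a"
  using rep_mult[of i "rep i e a" "inv (rep i e a) \<otimes> a" e] rep_coset[of i a e] rep_decomp[of i a e]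
  by simp

text \<open>The state \<open>([(t\<^sub>k, r\<^sub>k), \<dots>, (t\<^sub>1, r\<^sub>1)], a)\<close> stands for the normal form \<open>r\<^sub>1 t\<^sub>1 \<dots> r\<^sub>k t\<^sub>k a\<close>, where
  \<open>(i, True)\<close> and \<open>(i, False)\<close> are \<open>s\<^sub>i\<close> and its inverse; the last stable letter comes first in the list.\<close>

fun stable_act :: "'i \<times> bool \<Rightarrow> (('i \<times> bool) \<times> 'a) list \<times> 'a \<Rightarrow> (('i \<times> bool) \<times> 'a) list \<times> 'a" where
  "stable_act (i, e) (L, a) =
     (let r = rep i (\<not> e) a; h = \<theta> i (\<not> e) (inv r \<otimes> a)
      in if r = \<one> \<and> L \<noteq> [] \<and> fst (hd L) = (i, \<not> e) then (tl L, snd (hd L) \<otimes> h)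
         else (((i, e), r) # L, h))"

fun reduced :: "(('i \<times> bool) \<times> 'a) list \<Rightarrow> bool" where
  "reduced [] \<longleftrightarrow> True"
| "reduced (((i, e), r) # L) \<longleftrightarrow> i \<in> I \<and> r \<in> carrier A \<and> rep i (\<not> e) r = r \<and>
     \<not> (r = \<one> \<and> L \<noteq> [] \<and> fst (hd L) = (i, \<not> e)) \<and> reduced L"

definition states :: "((('i \<times> bool) \<times> 'a) list \<times> 'a) set" where
  "states = {(L, a). reduced L \<and> a \<in> carrier A}"

lemma stable_act_states:
  assumes "i \<in> I" "st \<in> states"
  shows "stable_act (i, e) st \<in> states"
proof -
  obtain L a where st: "st = (L, a)" "reduced L" "a \<in> carrier A"
    using assms by (auto simp: states_def)
  let ?r = "rep i (\<not> e) a"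
  have h: "\<theta> i (\<not> e) (inv ?r \<otimes> a) \<in> H i e"
    using \<theta>_closed' rep_coset assms st by blast
  have c: "\<theta> i (\<not> e) (inv ?r \<otimes> a) \<in> carrier A" using H_carrier[OF _ h] assms by simp
  show ?thesis
  proof (cases "?r = \<one> \<and> L \<noteq> [] \<and> fst (hd L) = (i, \<not> e)")
    case True
    then show ?thesis using st c by (cases L rule: reduced.cases) (auto simp: states_def Let_def)
  next
    case False
    then show ?thesis
      using st c assms rep_coset[of i a "\<not> e"] rep_rep[of i a "\<not> e"] by (auto simp: states_def Let_def)
  qed
qed

text \<open>A letter just pushed is popped again because the new tail lies in \<open>H i e\<close>
  and has representative \<open>\<one>\<close>. A letter just popped is pushed back because
  \<open>L\<close> was reduced, which excludes a second pop.\<close>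

lemma stable_act_cancel:
  assumes "i \<in> I" "st \<in> states"
  shows "stable_act (i, \<not> e) (stable_act (i, e) st) = st"
proof -
  obtain L a where st: "st = (L, a)" "reduced L" and a: "a \<in> carrier A"
    using assms by (auto simp: states_def)
  define r where "r = rep i (\<not> e) a"
  define k where "k = inv r \<otimes> a"
  have r: "r \<in> carrier A" and k: "k \<in> H i (\<not> e)" and a_eq: "a = r \<otimes> k"
    using rep_coset[of i a "\<not> e"] rep_decomp[of i a "\<not> e"] assms a by (auto simp: r_def k_def)
  define h where "h = \<theta> i (\<not> e) k"
  have h: "h \<in> H i e" "\<theta> i e h = k"
    using \<theta>_closed' \<theta>_inverse' k assms by (auto simp: h_def)
  have hc: "h \<in> carrier A" and kc: "k \<in> carrier A" using h k assms H_carrier by blast+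
  show ?thesis
  proof (cases "r = \<one> \<and> L \<noteq> [] \<and> fst (hd L) = (i, \<not> e)")
    case True
    then obtain r' L' where L: "L = ((i, \<not> e), r') # L'" by (cases L) auto
    then have r': "r' \<in> carrier A" "rep i e r' = r'" "\<not> (r' = \<one> \<and> L' \<noteq> [] \<and> fst (hd L') = (i, e))"
      using st by auto
    have 1: "stable_act (i, e) st = (L', r' \<otimes> h)"
      using True L unfolding st stable_act.simps Let_def r_def[symmetric] k_def[symmetric] h_def[symmetric]
      by simp
    have 2: "rep i e (r' \<otimes> h) = r'" using rep_mult r' h assms by simp
    have 3: "inv r' \<otimes> (r' \<otimes> h) = h" using r' hc by (simp add: m_assoc[symmetric])
    have "k = a" using a_eq True kc by simp
    then show ?thesis unfolding 1 using 2 3 r'(3) h(2) st(1) L by auto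
  next
    case False
    then have 1: "stable_act (i, e) st = (((i, e), r) # L, h)"
      unfolding st stable_act.simps Let_def r_def[symmetric] k_def[symmetric] h_def[symmetric]
      by auto
    have "rep i e h = \<one>" using h by (simp add: rep_def)
    then show ?thesis unfolding 1 using h hc a_eq st by (simp add: Let_def)
  qed
qed

text \<open>The factor \<open>h\<close> does not change the coset, hence not the representative and
  not the choice between push and pop; it only joins the part that crosses the letter. This is why
  the HNN relators will act trivially.\<close>

lemma stable_act_mult:
  assumes "i \<in> I" "a \<in> carrier A" "h \<in> H i (\<not> e)" "stable_act (i, e) (L, a) = (L', b)"
    and st: "(L, a) \<in> states"
  shows "stable_act (i, e) (L, a \<otimes> h) = (L', b \<otimes> \<theta> i (\<not> e) h)"
proof -
  define r where "r = rep i (\<not> e) a"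
  define k where "k = inv r \<otimes> a"
  have r: "r \<in> carrier A" and k: "k \<in> H i (\<not> e)"
    using rep_coset[of i a "\<not> e"] assms by (auto simp: r_def k_def)
  have hc: "h \<in> carrier A" using assms H_carrier by blast
  have 1: "rep i (\<not> e) (a \<otimes> h) = r" using rep_mult assms by (simp add: r_def)
  have 2: "inv r \<otimes> (a \<otimes> h) = k \<otimes> h" using r hc assms by (simp add: k_def m_assoc)
  have 3: "\<theta> i (\<not> e) (k \<otimes> h) = \<theta> i (\<not> e) k \<otimes> \<theta> i (\<not> e) h" using \<theta>_mult k assms by simp
  have 4: "\<theta> i (\<not> e) k \<in> carrier A" "\<theta> i (\<not> e) h \<in> carrier A"
    using \<theta>_closed'[of i _ e] k assms by (meson H_carrier)+
  have 5: "snd (hd L) \<in> carrier A" if "L \<noteq> []"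
    using st that by (cases L rule: reduced.cases) (auto simp: states_def)
  show ?thesis
    using assms(4) 1 2 3 4 5 unfolding stable_act.simps Let_def r_def[symmetric] k_def[symmetric]
    by (auto simp: m_assoc k_def[symmetric] split: if_splits)
qed

text \<open>The point is that the tail left after a push lies in \<open>H i e\<close>. Comparing
  such tails is how elements of the associated subgroups are recognized later.\<close>

lemma stable_act_push:
  assumes "i \<in> I" "a \<in> carrier A" "\<not> (a \<in> H i (\<not> e) \<and> L \<noteq> [] \<and> fst (hd L) = (i, \<not> e))"
  shows "\<exists>r. \<exists>h\<in>H i e. stable_act (i, e) (L, a) = (((i, e), r) # L, h)"
proof -
  let ?r = "rep i (\<not> e) a"
  have r: "?r \<in> carrier A" "inv ?r \<otimes> a \<in> H i (\<not> e)" using rep_coset assms by blast+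
  then have "\<theta> i (\<not> e) (inv ?r \<otimes> a) \<in> H i e" using \<theta>_closed' assms by blast
  moreover have "a \<in> H i (\<not> e)" if "?r = \<one>" using r that assms by simp
  ultimately show ?thesis using assms by (auto simp: Let_def)
qed

end

section \<open>Britton's lemma for words\<close>

lemma words_cases_last_stable:
  assumes "w \<in> words (hnn_gens X n)"
  obtains (base) c where "c \<in> words X" "w = base_word c"
  | (stable) p i e c where "p \<in> words (hnn_gens X n)" "i \<in> {1..n}" "c \<in> words X"
      "w = p @ [(Inr i, e)] @ base_word c"
proof -
  have "(\<exists>c\<in>words X. w = base_word c) \<or>
    (\<exists>p i e c. p \<in> words (hnn_gens X n) \<and> i \<in> {1..n} \<and> c \<in> words X \<and> w = p @ [(Inr i, e)] @ base_word c)"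
    using assms
  proof (induction w rule: rev_induct)
    case Nil
    show ?case by (auto simp: base_word_def intro!: bexI[of _ "[]"])
  next
    case (snoc a w)
    obtain y e where a: "a = (y, e)" by (cases a)
    show ?case
    proof (cases y)
      case (Inl x)
      with snoc a have x: "x \<in> X" by (auto simp: hnn_gens_def)
      have app: "base_word c @ [a] = base_word (c @ [(x, e)])" for c
        using a Inl by (simp add: base_word_def)
      have "w \<in> words (hnn_gens X n)" using snoc.prems by simp
      from snoc.IH[OF this] show ?thesis
      proof (elim disjE bexE exE conjE)
        fix c assume "c \<in> words X" "w = base_word c"
        then show ?thesis using x app by (intro disjI1 bexI[of _ "c @ [(x, e)]"]) auto
      next
        fix p i e' c
        assume "p \<in> words (hnn_gens X n)" "i \<in> {1..n}" "c \<in> words X" "w = p @ [(Inr i, e')] @ base_word c"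
        then show ?thesis using x app
          by (intro disjI2 exI[of _ p] exI[of _ i] exI[of _ e'] exI[of _ "c @ [(x, e)]"]) auto
      qed
    next
      case (Inr i)
      then show ?thesis using snoc.prems a
        by (intro disjI2 exI[of _ w] exI[of _ i] exI[of _ e] exI[of _ "[]"])
          (auto simp: hnn_gens_def base_word_def)
    qed
  qed
  then show thesis using base stable by blast
qed

lemma base_word_append: "base_word (c @ d) = base_word c @ base_word d"
  and length_base_word [simp]: "length (base_word c) = length c"
  and base_word_Nil [simp]: "base_word [] = []"
  by (simp_all add: base_word_def)

lemma take_base_word: "take i (base_word c) = base_word (take i c)"
  by (simp add: base_word_def take_map)

lemma word_inv_base_word: "word_inv (base_word c) = base_word (word_inv c)"
  by (induction c) (auto simp: word_inv_def base_word_def letter_inv_def)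

lemma base_word_in_words [simp]: "base_word c \<in> words (hnn_gens X n) \<longleftrightarrow> c \<in> words X"
  by (induction c) (auto simp: base_word_def hnn_gens_def)

lemma generated_group_presented_group:
  "generated_group (presented_group X R) (presented_gen X R) X"
proof -
  interpret group "presented_group X R" by (rule group_presented_group)
  show ?thesis
  proof
    show "presented_gen X R x \<in> carrier (presented_group X R)" if "x \<in> X" for x
      using that by (auto simp: presented_gen_def carrier_presented_group)
    show "\<exists>w\<in>words X. word_val (presented_group X R) (presented_gen X R) w = g"
      if "g \<in> carrier (presented_group X R)" for g
      using that by (auto simp: carrier_presented_group word_val_presented_group)
  qed
qed

lemma word_val_presented_eq_iff:
  assumes "w \<in> words X" "w' \<in> words X"
  shows "word_val (presented_group X R) (presented_gen X R) w = word_val (presented_group X R) (presented_gen X R) w'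
    \<longleftrightarrow> (w, w') \<in> pres_rel X R"
  using assms by (simp add: word_val_presented_group eq_equiv_class_iff[OF equiv_pres_rel])

declare One_nat_def [simp del]

locale isometric_HNN =
  fixes X :: "'x set" and R :: "'x word set" and n :: nat
    and U V :: "nat \<Rightarrow> 'x word set set" and \<phi> :: "nat \<Rightarrow> 'x word set \<Rightarrow> 'x word set"
    and m :: "nat \<Rightarrow> nat" and u v :: "nat \<Rightarrow> nat \<Rightarrow> 'x word"
  assumes isometric: "isometric_multiple_HNN X R n U V \<phi> m u v"
begin

abbreviation "A \<equiv> presented_group X R"
abbreviation "G \<equiv> presented_group (hnn_gens X n) (hnn_rels R n m u v)"
abbreviation "S \<equiv> hnn_gens X n"
abbreviation "\<iota>A \<equiv> presented_gen X R"
abbreviation "\<iota>G \<equiv> presented_gen (hnn_gens X n) (hnn_rels R n m u v)"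

sublocale A: generated_group A \<iota>A X
  by (rule generated_group_presented_group)

sublocale G: generated_group G \<iota>G S
  by (rule generated_group_presented_group)

text \<open>A pinch is \<open>(s\<^sub>i, e) c (s\<^sub>i, \<not> e)\<close> with \<open>c\<close> in \<open>H i e\<close>; the families below make the two kinds
  \<open>s\<^sub>i\<inverse> u s\<^sub>i = \<phi>\<^sub>i u\<close> and \<open>s\<^sub>i v s\<^sub>i\<inverse> = \<phi>\<^sub>i\<inverse> v\<close> symmetric in \<open>e\<close>.\<close>

definition H :: "nat \<Rightarrow> bool \<Rightarrow> 'x word set set" where
  "H i e = (if e then V i else U i)"

definition \<theta> :: "nat \<Rightarrow> bool \<Rightarrow> 'x word set \<Rightarrow> 'x word set" where
  "\<theta> i e = (if e then inv_into (U i) (\<phi> i) else \<phi> i)"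

definition f :: "nat \<Rightarrow> bool \<Rightarrow> nat \<Rightarrow> 'x word" where
  "f i e = (if e then v i else u i)"

lemma hnn:
  assumes "i \<in> {1..n}"
  shows "subgroup (U i) A" "subgroup (V i) A" "\<phi> i \<in> iso (A\<lparr>carrier := U i\<rparr>) (A\<lparr>carrier := V i\<rparr>)"
    "\<And>j. j \<in> {1..m i} \<Longrightarrow> u i j \<in> words X" "\<And>j. j \<in> {1..m i} \<Longrightarrow> v i j \<in> words X"
    "U i = generate A ((\<lambda>j. A.val (u i j)) ` {1..m i})"
    "\<And>j. j \<in> {1..m i} \<Longrightarrow> A.val (v i j) = \<phi> i (A.val (u i j))"
    "\<And>j. j \<in> {1..m i} \<Longrightarrow> length (u i j) = length (v i j)"
    "\<And>w. geodesic_word A \<iota>A X w \<Longrightarrow> A.val w \<in> U i \<Longrightarrow> w \<in> expand (u i) ` words {1..m i}"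
    "\<And>w. geodesic_word A \<iota>A X w \<Longrightarrow> A.val w \<in> V i \<Longrightarrow> w \<in> expand (v i) ` words {1..m i}"
  using isometric assms
  unfolding isometric_multiple_HNN_def multiple_HNN_def totally_geodesic_family_def Let_def
  by blast+

lemma geodesic_in_H:
  "i \<in> {1..n} \<Longrightarrow> geodesic_word A \<iota>A X w \<Longrightarrow> A.val w \<in> H i e \<Longrightarrow> \<exists>z\<in>words {1..m i}. w = expand (f i e) z"
  using hnn(9,10)[of i w] by (auto simp: H_def f_def split: if_splits)

lemma f_words: "i \<in> {1..n} \<Longrightarrow> j \<in> {1..m i} \<Longrightarrow> f i e j \<in> words X"
  using hnn(4,5) by (simp add: f_def)

lemma length_f: "i \<in> {1..n} \<Longrightarrow> j \<in> {1..m i} \<Longrightarrow> length (f i e j) = length (f i e' j)"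
  using hnn(8) by (simp add: f_def)

sublocale B: HNN_data A "{1..n}" H \<theta>
proof (rule HNN_data.intro[OF group_presented_group], rule HNN_data_axioms.intro)
  fix i e assume i: "i \<in> {1..n}"
  show "subgroup (H i e) A" using hnn(1,2)[OF i] by (simp add: H_def)
  have bij: "bij_betw (\<phi> i) (U i) (V i)" using hnn(3)[OF i] by (simp add: iso_def)
  let ?U = "A\<lparr>carrier := U i\<rparr>" and ?V = "A\<lparr>carrier := V i\<rparr>"
  interpret U: group ?U using hnn(1)[OF i] by (rule A.subgroup_imp_group)
  have "inv_into (carrier ?U) (\<phi> i) \<in> iso ?V ?U" using hnn(3)[OF i] by (rule U.iso_set_sym)
  then have inv: "inv_into (U i) (\<phi> i) \<in> hom ?V ?U" by (simp add: iso_def)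
  show "\<theta> i e h \<in> H i (\<not> e)" if "h \<in> H i e" for h
    using that bij by (auto simp: H_def \<theta>_def bij_betw_def inv_into_into split: if_splits)
  show "\<theta> i (\<not> e) (\<theta> i e h) = h" if "h \<in> H i e" for h
    using that bij by (auto simp: H_def \<theta>_def bij_betw_def inv_into_f_f f_inv_into_f split: if_splits)
  show "\<theta> i e (h \<otimes>\<^bsub>A\<^esub> h') = \<theta> i e h \<otimes>\<^bsub>A\<^esub> \<theta> i e h'" if "h \<in> H i e" "h' \<in> H i e" for h h'
    using that hom_mult[OF inv, of h h'] hom_mult[of "\<phi> i" ?U ?V h h'] hnn(3)[OF i]
    by (auto simp: H_def \<theta>_def iso_def split: if_splits)
qed

section \<open>The right action of words on normal forms (van der Waerden's method)\<close>

definition act :: "((nat \<times> bool) \<times> 'x word set) list \<times> 'x word set \<Rightarrow> ('x + nat) letter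
    \<Rightarrow> ((nat \<times> bool) \<times> 'x word set) list \<times> 'x word set" where
  "act st a = (case fst a of Inl x \<Rightarrow> (fst st, snd st \<otimes>\<^bsub>A\<^esub> A.val [(x, snd a)])
                           | Inr i \<Rightarrow> B.stable_act (i, snd a) st)"

lemma act_states:
  assumes "fst a \<in> S" "st \<in> B.states"
  shows "act st a \<in> B.states"
proof (cases "fst a")
  case (Inl x)
  then have "x \<in> X" using assms by (auto simp: hnn_gens_def)
  then have "A.val [(x, snd a)] \<in> carrier A" by (intro A.val_closed) simp
  then show ?thesis using Inl assms by (cases st) (auto simp: act_def B.states_def simp del: word_val.simps)
next
  case (Inr i)
  then have "i \<in> {1..n}" using assms by (auto simp: hnn_gens_def)
  then show ?thesis using B.stable_act_states Inr assms by (simp add: act_def)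
qed

lemma foldl_act_states: "w \<in> words S \<Longrightarrow> st \<in> B.states \<Longrightarrow> foldl act st w \<in> B.states"
proof (induction w arbitrary: st)
  case (Cons a w)
  then have "act st a \<in> B.states" using act_states by simp
  then show ?case using Cons by simp
qed simp

lemma act_cancel:
  assumes "fst a \<in> S" "st \<in> B.states"
  shows "act (act st a) (letter_inv a) = st"
proof (cases "fst a")
  case (Inl x)
  then have x: "x \<in> X" using assms by (auto simp: hnn_gens_def)
  then have v: "A.val [(x, snd a)] \<in> carrier A" by (intro A.val_closed) simp
  have "A.val [(x, \<not> snd a)] = inv\<^bsub>A\<^esub> (A.val [(x, snd a)])"
    using A.val_letter_inv[of "(x, snd a)"] x by (simp add: letter_inv_def)
  then show ?thesis using Inl assms v
    by (cases st) (auto simp: act_def B.states_def letter_inv_def A.m_assoc simp del: word_val.simps)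
next
  case (Inr i)
  then have "i \<in> {1..n}" using assms by (auto simp: hnn_gens_def)
  then show ?thesis using B.stable_act_cancel Inr assms by (simp add: act_def letter_inv_def)
qed

lemma foldl_act_base_word:
  "c \<in> words X \<Longrightarrow> b \<in> carrier A \<Longrightarrow> foldl act (L, b) (base_word c) = (L, b \<otimes>\<^bsub>A\<^esub> A.val c)"
proof (induction c arbitrary: b)
  case (Cons a c)
  have a: "A.val [a] \<in> carrier A" using Cons.prems by (intro A.val_closed) simp
  have "A.val ([a] @ c) = A.val [a] \<otimes>\<^bsub>A\<^esub> A.val c" using Cons.prems by (intro A.val_append) auto
  then have ac: "A.val (a # c) = A.val [a] \<otimes>\<^bsub>A\<^esub> A.val c" by simp
  have "act (L, b) (Inl (fst a), snd a) = (L, b \<otimes>\<^bsub>A\<^esub> A.val [a])" by (simp add: act_def)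
  moreover have "base_word (a # c) = (Inl (fst a), snd a) # base_word c"
    by (simp add: base_word_def case_prod_unfold)
  moreover have "foldl act (L, b \<otimes>\<^bsub>A\<^esub> A.val [a]) (base_word c) = (L, b \<otimes>\<^bsub>A\<^esub> A.val [a] \<otimes>\<^bsub>A\<^esub> A.val c)"
    using Cons a by (intro Cons.IH) (auto simp del: word_val.simps)
  ultimately show ?case using Cons.prems a unfolding ac by (simp add: A.m_assoc del: word_val.simps)
qed simp

text \<open>Without \<open>u i j\<close> the two stable letters undo each other. By
  \<open>stable_act_mult\<close> the inserted \<open>u i j\<close> comes out behind the second
  letter as \<open>v i j\<close>, which the last factor of the relator removes.\<close>

lemma foldl_act_hnn_rel:
  assumes i: "i \<in> {1..n}" and j: "j \<in> {1..m i}" and st: "st \<in> B.states"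
  shows "foldl act st ([(Inr i, False)] @ base_word (u i j) @ [(Inr i, True)] @ word_inv (base_word (v i j))) = st"
proof -
  obtain L a where st': "st = (L, a)" "a \<in> carrier A" using st by (auto simp: B.states_def)
  obtain L1 b1 where 1: "B.stable_act (i, False) st = (L1, b1)" by (metis surj_pair)
  then have b1: "(L1, b1) \<in> B.states" "b1 \<in> carrier A"
    using B.stable_act_states[OF i st, of False] by (auto simp: B.states_def)
  have w: "u i j \<in> words X" "v i j \<in> words X" using hnn(4,5) i j by auto
  have "A.val (u i j) \<in> U i"
    unfolding hnn(6)[OF i] by (rule generate.incl) (use j in blast)
  then have u: "A.val (u i j) \<in> H i (\<not> True)" by (simp add: H_def)
  have \<theta>u: "\<theta> i False (A.val (u i j)) = A.val (v i j)" using hnn(7) i j by (simp add: \<theta>_def)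
  have "B.stable_act (i, True) (L1, b1) = (L, a)"
    using B.stable_act_cancel[OF i st, of False] 1 st' by simp
  from B.stable_act_mult[OF i b1(2) u this b1(1)] \<theta>u
  have 2: "B.stable_act (i, True) (L1, b1 \<otimes>\<^bsub>A\<^esub> A.val (u i j)) = (L, a \<otimes>\<^bsub>A\<^esub> A.val (v i j))" by simp
  have "foldl act st ([(Inr i, False)] @ base_word (u i j) @ [(Inr i, True)] @ word_inv (base_word (v i j)))
     = (L, a \<otimes>\<^bsub>A\<^esub> A.val (v i j) \<otimes>\<^bsub>A\<^esub> A.val (word_inv (v i j)))"
    using w st' b1 1 2 by (simp add: act_def foldl_act_base_word word_inv_base_word del: B.stable_act.simps)
  also have "\<dots> = st"
    using w st' by (simp add: A.val_word_inv A.m_assoc)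
  finally show ?thesis .
qed

lemma foldl_act_pres_rel:
  "(w, w') \<in> pres_rel S (hnn_rels R n m u v) \<Longrightarrow> st \<in> B.states \<Longrightarrow> foldl act st w = foldl act st w'"
proof (induction arbitrary: st rule: pres_rel.induct)
  case (cancel p q a)
  then show ?case using act_cancel[OF cancel(3) foldl_act_states[OF cancel(1,4)]] by simp
next
  case (relator p q r)
  let ?t = "foldl act st p"
  have t: "?t \<in> B.states" using relator foldl_act_states by blast
  consider (base) c where "c \<in> R" "r = base_word c"
    | (stable) i j where "i \<in> {1..n}" "j \<in> {1..m i}"
      "r = [(Inr i, False)] @ base_word (u i j) @ [(Inr i, True)] @ word_inv (base_word (v i j))"
    using relator(3) unfolding hnn_rels_def by blast
  then have "foldl act ?t r = ?t"
  proof cases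
    case base
    then have c: "c \<in> words X" using relator by simp
    have "(c, []) \<in> pres_rel X R" using pres_rel.relator[of "[]" X "[]" c R] base c by simp
    then have "A.val c = \<one>\<^bsub>A\<^esub>" using word_val_presented_eq_iff[of c X "[]" R] c by simp
    then show ?thesis using foldl_act_base_word[OF c] t base by (cases ?t) (auto simp: B.states_def)
  next
    case stable
    then show ?thesis using foldl_act_hnn_rel t by blast
  qed
  then show ?case by simp
qed auto

definition pinch_free :: "('x + nat) word \<Rightarrow> bool" where
  "pinch_free w \<longleftrightarrow> (\<nexists>p i e c q. w = p @ [(Inr i, e)] @ base_word c @ [(Inr i, \<not> e)] @ q \<and>
     c \<in> words X \<and> A.val c \<in> H i e)"

lemma pinch_free_prefix: "pinch_free (p @ q) \<Longrightarrow> pinch_free p"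
  unfolding pinch_free_def by (metis append.assoc)

definition state :: "('x + nat) word \<Rightarrow> ((nat \<times> bool) \<times> 'x word set) list \<times> 'x word set" where
  "state w = foldl act ([], \<one>\<^bsub>A\<^esub>) w"

lemma state_base_word: "c \<in> words X \<Longrightarrow> state (base_word c) = ([], A.val c)"
  by (simp add: state_def foldl_act_base_word)

lemma state_append_base_word:
  "state w = (L, b) \<Longrightarrow> b \<in> carrier A \<Longrightarrow> c \<in> words X \<Longrightarrow> state (w @ base_word c) = (L, b \<otimes>\<^bsub>A\<^esub> A.val c)"
  by (simp add: state_def foldl_act_base_word)

lemma state_cong:
  assumes "w \<in> words S" "w' \<in> words S" "G.val w = G.val w'"
  shows "state w = state w'"
proof -
  have "(w, w') \<in> pres_rel S (hnn_rels R n m u v)" using assms by (simp add: word_val_presented_eq_iff)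
  moreover have "([], \<one>\<^bsub>A\<^esub>) \<in> B.states" by (simp add: B.states_def)
  ultimately show ?thesis unfolding state_def by (rule foldl_act_pres_rel)
qed

text \<open>Britton's lemma: no cancellation of stable letters ever takes place along a pinch-free word.\<close>

lemma state_pinch_free:
  assumes "pinch_free (p @ [(Inr i, e)] @ base_word c)" "p \<in> words S" "i \<in> {1..n}" "c \<in> words X"
  shows "\<exists>L r. \<exists>h\<in>H i e. state (p @ [(Inr i, e)] @ base_word c) = (((i, e), r) # L, h \<otimes>\<^bsub>A\<^esub> A.val c)"
  using assms
proof (induction "length p" arbitrary: p i e c rule: less_induct)
  case less
  obtain L b where st: "state p = (L, b)" by (metis surj_pair)
  have b: "b \<in> carrier A"
    using foldl_act_states[OF less.prems(2), of "([], \<one>\<^bsub>A\<^esub>)"] st by (auto simp: state_def B.states_def)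
  \<comment> \<open>By induction the tail after \<open>p\<close> is an element of
    \<open>H i' e'\<close> times the last base segment of \<open>p\<close>. If the new letter
    cancelled, that segment would lie in \<open>H i' e'\<close> too and form a pinch with the new
    letter.\<close>
  have "\<not> (b \<in> H i (\<not> e) \<and> L \<noteq> [] \<and> fst (hd L) = (i, \<not> e))"
    using less.prems(2)
  proof (cases rule: words_cases_last_stable)
    case (base c')
    then show ?thesis using st state_base_word by simp
  next
    case (stable p' i' e' c')
    have "pinch_free p" using less.prems(1) pinch_free_prefix by blast
    with less.hyps[of p' i' e' c'] stable obtain L' r h
      where h: "h \<in> H i' e'" "state p = (((i', e'), r) # L', h \<otimes>\<^bsub>A\<^esub> A.val c')" by auto
    show ?thesis
    proof
      assume a: "b \<in> H i (\<not> e) \<and> L \<noteq> [] \<and> fst (hd L) = (i, \<not> e)"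
      then have i': "i' = i" "e' = (\<not> e)" and b': "b = h \<otimes>\<^bsub>A\<^esub> A.val c'" using h st by auto
      have "A.val c' \<in> H i e'"
        using a b' h i' stable less.prems(3) B.H_mult_left_iff[of i h e' "A.val c'"] by auto
      moreover have "p @ [(Inr i, e)] @ base_word c
          = p' @ [(Inr i, e')] @ base_word c' @ [(Inr i, \<not> e')] @ base_word c"
        using stable i' by simp
      ultimately show False using less.prems(1) stable unfolding pinch_free_def by blast
    qed
  qed
  from B.stable_act_push[OF less.prems(3) b this] obtain r h
    where h: "h \<in> H i e" "B.stable_act (i, e) (L, b) = (((i, e), r) # L, h)" by blast
  then have "state (p @ [(Inr i, e)]) = (((i, e), r) # L, h)"
    using st by (simp add: state_def act_def del: B.stable_act.simps)
  moreover have "h \<in> carrier A" using B.H_carrier h(1) less.prems(3) by blast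
  ultimately have "state ((p @ [(Inr i, e)]) @ base_word c) = (((i, e), r) # L, h \<otimes>\<^bsub>A\<^esub> A.val c)"
    using state_append_base_word less.prems(4) by blast
  with h(1) show ?case by auto
qed

end

section \<open>Strips\<close>

lemma expand_Nil [simp]: "expand g [] = []"
  and expand_Cons: "expand g ((j, e) # z) = (if e then g j else word_inv (g j)) @ expand g z"
  and expand_append: "expand g (z @ z') = expand g z @ expand g z'"
  by (simp_all add: expand_def)

lemma expand_words:
  "z \<in> words J \<Longrightarrow> (\<And>j. j \<in> J \<Longrightarrow> g j \<in> words X) \<Longrightarrow> expand g z \<in> words X"
  by (induction z) (auto simp: expand_Cons)

lemma length_expand:
  "z \<in> words J \<Longrightarrow> (\<And>j. j \<in> J \<Longrightarrow> length (g j) = length (g' j)) \<Longrightarrow>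
     length (expand g z) = length (expand g' z)"
  by (induction z) (auto simp: expand_Cons)

lemma take_expand: "take (length (expand g (take k z))) (expand g z) = expand g (take k z)"
  by (metis append_eq_conv_conj append_take_drop_id expand_append)

text \<open>A strip can be crossed only where one generator ends and the next begins. Positions are
  rounded to such boundaries, here downwards and in \<open>expand_block_above\<close> upwards, at a
  cost of at most one generator.\<close>

lemma expand_block_below:
  assumes "z \<in> words J" "\<And>j. j \<in> J \<Longrightarrow> length (g j) \<le> M" "q \<le> length (expand g z)"
  shows "\<exists>k. length (expand g (take k z)) \<le> q \<and> q \<le> length (expand g (take k z)) + M"
  using assms
proof (induction z arbitrary: q)
  case (Cons a z)
  obtain j e where a: "a = (j, e)" by (cases a)
  have j: "length (g j) \<le> M" using Cons.prems a by simp
  show ?case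
  proof (cases "q \<le> length (g j)")
    case True
    then show ?thesis using j by (intro exI[of _ 0]) auto
  next
    case False
    then have "q - length (g j) \<le> length (expand g z)"
      using Cons.prems(3) a by (auto simp: expand_Cons split: if_splits)
    with Cons obtain k where "length (expand g (take k z)) \<le> q - length (g j)"
      "q - length (g j) \<le> length (expand g (take k z)) + M" by auto
    then show ?thesis using False a by (intro exI[of _ "Suc k"]) (auto simp: expand_Cons)
  qed
qed auto

lemma expand_block_above:
  assumes "z \<in> words J" "\<And>j. j \<in> J \<Longrightarrow> length (g j) \<le> M" "q \<le> length (expand g z)"
  shows "\<exists>k. q \<le> length (expand g (take k z)) \<and> length (expand g (take k z)) \<le> q + M"
  using assms
proof (induction z arbitrary: q)
  case (Cons a z)
  obtain j e where a: "a = (j, e)" by (cases a)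
  have j: "length (g j) \<le> M" using Cons.prems a by simp
  show ?case
  proof (cases "q \<le> length (g j)")
    case True
    then show ?thesis using j a by (intro exI[of _ "Suc 0"]) (auto simp: expand_Cons)
  next
    case False
    then have "q - length (g j) \<le> length (expand g z)"
      using Cons.prems(3) a by (auto simp: expand_Cons split: if_splits)
    with Cons obtain k where "q - length (g j) \<le> length (expand g (take k z))"
      "length (expand g (take k z)) \<le> q - length (g j) + M" by auto
    then show ?thesis using False a by (intro exI[of _ "Suc k"]) (auto simp: expand_Cons)
  qed
qed auto

lemma length_expand_take_mono: "k \<le> k' \<Longrightarrow> length (expand g (take k z)) \<le> length (expand g (take k' z))"
  by (metis expand_append le_add1 le_add_diff_inverse length_append take_add)

lemma length_expand_take_le: "length (expand g (take k z)) \<le> length (expand g z)"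
  by (metis append_take_drop_id expand_append le_add1 length_append)

lemma expand_blocks_around:
  assumes "z \<in> words J" "\<And>j. j \<in> J \<Longrightarrow> length (g j) \<le> M" "r \<le> t" "t \<le> length (expand g z)"
  obtains k k' where "k \<le> k'" "length (expand g (take k z)) \<le> r" "r \<le> length (expand g (take k z)) + M"
    "t \<le> length (expand g (take k' z))" "length (expand g (take k' z)) \<le> t + M"
proof -
  obtain k where k: "length (expand g (take k z)) \<le> r" "r \<le> length (expand g (take k z)) + M"
    using expand_block_below[of z J g M r] assms by auto
  obtain k' where k': "t \<le> length (expand g (take k' z))" "length (expand g (take k' z)) \<le> t + M"
    using expand_block_above[of z J g M t] assms by auto
  show thesis
  proof (cases "k \<le> k'")
    case True
    then show ?thesis using that k k' by blast
  next
    case False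
    \<comment> \<open>Now \<open>k' < k\<close>, which forces both boundaries, \<open>r\<close> and
      \<open>t\<close> to be the same position; \<open>k'\<close> can be used twice.\<close>
    then have "length (expand g (take k' z)) \<le> length (expand g (take k z))"
      using length_expand_take_mono[of k' k g z] by simp
    with that[of k' k'] k k' assms(3) show ?thesis by simp
  qed
qed

text \<open>Lets strips run along inverse generators as well, since \<open>expand\<close> uses both
  signs.\<close>

lemma (in group) intertwine_inv:
  assumes "s \<in> carrier G" "x \<in> carrier G" "y \<in> carrier G" "s \<otimes> x = y \<otimes> s"
  shows "s \<otimes> inv x = inv y \<otimes> s"
proof -
  have "inv y \<otimes> (s \<otimes> x) \<otimes> inv x = inv y \<otimes> (y \<otimes> s) \<otimes> inv x" using assms by simp
  moreover have "inv y \<otimes> (s \<otimes> x) \<otimes> inv x = inv y \<otimes> s" using assms(1-3) by (simp add: m_assoc)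
  moreover have "inv y \<otimes> (y \<otimes> s) \<otimes> inv x = s \<otimes> inv x"
    using assms(1-3) by (simp add: m_assoc[symmetric])
  ultimately show ?thesis by simp
qed

declare word_val.simps(2) [simp del]

context isometric_HNN
begin

section \<open>The base group and the stable letters inside the extension\<close>

abbreviation mult_G (infixl "\<cdot>" 70) where "mult_G \<equiv> mult G"

abbreviation bval :: "'x word \<Rightarrow> ('x + nat) word set" where
  "bval c \<equiv> G.val (base_word c)"

abbreviation \<sigma> :: "nat \<Rightarrow> bool \<Rightarrow> ('x + nat) word set" where
  "\<sigma> i e \<equiv> G.val [(Inr i, e)]"

lemma bval_append: "c \<in> words X \<Longrightarrow> d \<in> words X \<Longrightarrow> bval (c @ d) = bval c \<cdot> bval d"
  by (simp add: base_word_append G.val_append)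

lemma bval_word_inv: "c \<in> words X \<Longrightarrow> bval (word_inv c) = inv\<^bsub>G\<^esub> (bval c)"
  using G.val_word_inv[of "base_word c"] by (simp add: word_inv_base_word)

lemma stable_in_gens: "i \<in> {1..n} \<Longrightarrow> [(Inr i, e)] \<in> words S"
  by (auto simp: hnn_gens_def)

lemma \<sigma>_closed: "i \<in> {1..n} \<Longrightarrow> \<sigma> i e \<in> carrier G"
  by (intro G.val_closed stable_in_gens)

lemma \<sigma>_inv: "i \<in> {1..n} \<Longrightarrow> \<sigma> i (\<not> e) = inv\<^bsub>G\<^esub> (\<sigma> i e)"
  using G.val_letter_inv[of "(Inr i, e)"] by (auto simp: letter_inv_def hnn_gens_def)

lemma val_append_stable:
  assumes "p \<in> words S" "i \<in> {1..n}" "c \<in> words X"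
  shows "G.val (p @ [(Inr i, e)] @ base_word c) = G.val p \<cdot> \<sigma> i e \<cdot> bval c"
proof -
  have "G.val ((p @ [(Inr i, e)]) @ base_word c) = G.val p \<cdot> \<sigma> i e \<cdot> bval c"
    using assms stable_in_gens by (subst G.val_append) (auto simp: G.val_append)
  then show ?thesis by simp
qed

lemma base_word_pres_rel:
  "(c, d) \<in> pres_rel X R \<Longrightarrow> (base_word c, base_word d) \<in> pres_rel S (hnn_rels R n m u v)"
proof (induction rule: pres_rel.induct)
  case (cancel p q a)
  have "base_word [a, letter_inv a] = [(Inl (fst a), snd a), letter_inv (Inl (fst a), snd a)]"
    by (cases a) (simp add: base_word_def letter_inv_def)
  moreover have "Inl (fst a) \<in> S" using cancel by (simp add: hnn_gens_def)
  ultimately show ?case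
    using cancel pres_rel.cancel[of "base_word p" S "base_word q" "(Inl (fst a), snd a)" "hnn_rels R n m u v"]
    by (simp only: base_word_append) simp
next
  case (relator p q r)
  then show ?case
    using pres_rel.relator[of "base_word p" S "base_word q" "base_word r"]
    by (auto simp: base_word_append hnn_rels_def)
qed (auto intro: pres_rel.intros)

lemma bval_cong:
  assumes "c \<in> words X" "d \<in> words X" "A.val c = A.val d"
  shows "bval c = bval d"
proof -
  have "(c, d) \<in> pres_rel X R" using assms by (simp add: word_val_presented_eq_iff)
  from base_word_pres_rel[OF this] show ?thesis using assms by (simp add: word_val_presented_eq_iff)
qed

text \<open>A shortest word of the base group is also a word of the extension, so distances can only
  shrink. Fellow traveling in the base group therefore persists in every translate by
  \<open>P\<close>.\<close>

lemma gdist_bval_le: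
  assumes P: "P \<in> carrier G" and c: "c \<in> words X" and d: "d \<in> words X"
  shows "G.gdist (P \<cdot> bval c) (P \<cdot> bval d) \<le> A.gdist (A.val c) (A.val d)"
proof -
  obtain w where w: "w \<in> words X" "length w = A.gdist (A.val c) (A.val d)" "A.val c \<otimes>\<^bsub>A\<^esub> A.val w = A.val d"
    using A.gdist_witness c d by (metis A.val_closed)
  have "bval (c @ w) = bval d" using w c d by (intro bval_cong) (auto simp: A.val_append)
  then have "P \<cdot> bval c \<cdot> bval w = P \<cdot> bval d" using w c P by (simp add: bval_append G.m_assoc)
  then have "G.gdist (P \<cdot> bval c) (P \<cdot> bval d) \<le> length (base_word w)" using w by (intro G.gdist_le) auto
  then show ?thesis using w by simp
qed

text \<open>The HNN relator read as a commuting square; multiplying by the inverse stable letter on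
  both sides gives the square for the other sign.\<close>

lemma stable_f:
  assumes i: "i \<in> {1..n}" and j: "j \<in> {1..m i}"
  shows "\<sigma> i e \<cdot> bval (f i e j) = bval (f i (\<not> e) j) \<cdot> \<sigma> i e"
proof -
  define s where "s = \<sigma> i True"
  define x where "x = bval (u i j)"
  define y where "y = bval (v i j)"
  have w: "u i j \<in> words X" "v i j \<in> words X" using hnn(4,5) i j by auto
  have c: "s \<in> carrier G" "x \<in> carrier G" "y \<in> carrier G"
    using \<sigma>_closed[OF i] w by (auto simp: s_def x_def y_def)
  have F: "\<sigma> i False = inv\<^bsub>G\<^esub> s" using \<sigma>_inv[OF i, of True] by (simp add: s_def)
  let ?r = "[(Inr i, False)] @ base_word (u i j) @ [(Inr i, True)] @ word_inv (base_word (v i j))"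
  have r: "?r \<in> words S" using w stable_in_gens[OF i] by simp
  have "?r \<in> hnn_rels R n m u v" using i j unfolding hnn_rels_def by blast
  then have "(?r, []) \<in> pres_rel S (hnn_rels R n m u v)"
    using pres_rel.relator[of "[]" S "[]" ?r] r by simp
  then have "G.val ?r = \<one>\<^bsub>G\<^esub>" using word_val_presented_eq_iff[of ?r S "[]"] r by simp
  moreover have "G.val ?r = inv\<^bsub>G\<^esub> s \<cdot> (x \<cdot> (s \<cdot> inv\<^bsub>G\<^esub> y))"
  proof -
    have "G.val ([(Inr i, True)] @ word_inv (base_word (v i j))) = s \<cdot> inv\<^bsub>G\<^esub> y"
      using w stable_in_gens[OF i] by (subst G.val_append) (auto simp: G.val_word_inv s_def y_def)
    moreover have "[(Inr i, True)] @ word_inv (base_word (v i j)) \<in> words S"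
      using w stable_in_gens[OF i] by simp
    ultimately have "G.val (base_word (u i j) @ ([(Inr i, True)] @ word_inv (base_word (v i j)))) = x \<cdot> (s \<cdot> inv\<^bsub>G\<^esub> y)"
      using w by (subst G.val_append) (auto simp: x_def)
    moreover have "base_word (u i j) @ [(Inr i, True)] @ word_inv (base_word (v i j)) \<in> words S"
      using w stable_in_gens[OF i] by simp
    ultimately show ?thesis
      using stable_in_gens[OF i] F by (subst G.val_append) auto
  qed
  ultimately have "s \<cdot> (inv\<^bsub>G\<^esub> s \<cdot> (x \<cdot> (s \<cdot> inv\<^bsub>G\<^esub> y))) = s" using c by simp
  then have "x \<cdot> (s \<cdot> inv\<^bsub>G\<^esub> y) \<cdot> y = s \<cdot> y" using c by (simp add: G.m_assoc[symmetric])
  then have xs: "x \<cdot> s = s \<cdot> y" using c by (simp add: G.m_assoc)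
  have "inv\<^bsub>G\<^esub> s \<cdot> x = y \<cdot> inv\<^bsub>G\<^esub> s"
  proof -
    have "inv\<^bsub>G\<^esub> s \<cdot> (x \<cdot> s) \<cdot> inv\<^bsub>G\<^esub> s = inv\<^bsub>G\<^esub> s \<cdot> (s \<cdot> y) \<cdot> inv\<^bsub>G\<^esub> s" using xs by simp
    moreover have "inv\<^bsub>G\<^esub> s \<cdot> (x \<cdot> s) \<cdot> inv\<^bsub>G\<^esub> s = inv\<^bsub>G\<^esub> s \<cdot> x" using c by (simp add: G.m_assoc)
    moreover have "inv\<^bsub>G\<^esub> s \<cdot> (s \<cdot> y) \<cdot> inv\<^bsub>G\<^esub> s = y \<cdot> inv\<^bsub>G\<^esub> s" using c by (simp add: G.m_assoc[symmetric])
    ultimately show ?thesis by simp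
  qed
  then show ?thesis
    using xs F by (cases e) (simp_all add: f_def s_def[symmetric] x_def[symmetric] y_def[symmetric])
qed

lemma f_words': "i \<in> {1..n} \<Longrightarrow> z \<in> words {1..m i} \<Longrightarrow> expand (f i e) z \<in> words X"
  using expand_words f_words by metis

lemma length_expand_f:
  "i \<in> {1..n} \<Longrightarrow> z \<in> words {1..m i} \<Longrightarrow> length (expand (f i e) z) = length (expand (f i e') z)"
  using length_expand[of z "{1..m i}" "f i e" "f i e'"] length_f by blast

text \<open>The squares of \<open>stable_f\<close>, glued along their stable edges, form a strip
  with the two expansions of \<open>z\<close> as its sides.\<close>

lemma stable_expand:
  assumes i: "i \<in> {1..n}" and z: "z \<in> words {1..m i}"
  shows "\<sigma> i e \<cdot> bval (expand (f i e) z) = bval (expand (f i (\<not> e)) z) \<cdot> \<sigma> i e"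
  using z
proof (induction z)
  case Nil
  then show ?case using \<sigma>_closed[OF i] by simp
next
  case (Cons a z)
  obtain j b where a: "a = (j, b)" by (cases a)
  have j: "j \<in> {1..m i}" and z: "z \<in> words {1..m i}" using Cons.prems a by auto
  define x where "x e = (if b then f i e j else word_inv (f i e j))" for e
  have x: "x e \<in> words X" for e using f_words i j by (simp add: x_def)
  have e: "expand (f i e) (a # z) = x e @ expand (f i e) z" for e by (simp add: a x_def expand_Cons)
  have fw: "f i e j \<in> words X" for e using f_words i j by simp
  have 1: "\<sigma> i e \<cdot> bval (x e) = bval (x (\<not> e)) \<cdot> \<sigma> i e"
    using stable_f[OF i j, of e] G.intertwine_inv[of "\<sigma> i e" "bval (f i e j)" "bval (f i (\<not> e) j)"] fw \<sigma>_closed[OF i]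
    by (simp add: x_def bval_word_inv)
  have zw: "expand (f i e) z \<in> words X" for e using f_words' i z by blast
  have "\<sigma> i e \<cdot> bval (expand (f i e) (a # z)) = \<sigma> i e \<cdot> bval (x e) \<cdot> bval (expand (f i e) z)"
    using x zw \<sigma>_closed[OF i] by (simp add: e bval_append G.m_assoc)
  also have "\<dots> = bval (x (\<not> e)) \<cdot> (\<sigma> i e \<cdot> bval (expand (f i e) z))"
    using 1 x zw \<sigma>_closed[OF i] by (simp add: G.m_assoc)
  also have "\<dots> = bval (expand (f i (\<not> e)) (a # z)) \<cdot> \<sigma> i e"
    using Cons.IH[OF z] x zw \<sigma>_closed[OF i] by (simp add: e bval_append G.m_assoc)
  finally show ?case .
qed

section \<open>Pinches do not occur in geodesics\<close>

lemma geodesic_representative: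
  assumes "c \<in> words X"
  obtains c' where "geodesic_word A \<iota>A X c'" "A.val c' = A.val c" "length c' \<le> length c"
proof -
  obtain c' where c': "c' \<in> words X" "length c' = A.lev (A.val c)" "A.val c' = A.val c"
    using A.lev_witness assms A.val_closed by metis
  have "length c' \<le> length d" if "d \<in> words X" "A.val d = A.val c" for d
    using A.lev_val[OF that(1)] that(2) c' by simp
  then have "geodesic_word A \<iota>A X c'" "length c' \<le> length c"
    using c' assms by (auto simp: geodesic_word_def not_less)
  then show thesis using that c' by blast
qed

text \<open>A geodesic for the element of \<open>c\<close> is spelled in the generators of the
  associated subgroup by total geodesicity. The other side of its strip is \<open>d\<close>, equally
  long because corresponding generators have equal length.\<close>

lemma pinch_shortcut:
  assumes i: "i \<in> {1..n}" and c: "c \<in> words X" "A.val c \<in> H i e"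
  shows "\<exists>d\<in>words X. length d \<le> length c \<and> \<sigma> i e \<cdot> bval c \<cdot> \<sigma> i (\<not> e) = bval d"
proof -
  obtain c' where c': "geodesic_word A \<iota>A X c'" "A.val c' = A.val c" "length c' \<le> length c"
    using geodesic_representative c by blast
  obtain z where z: "z \<in> words {1..m i}" "c' = expand (f i e) z"
    using geodesic_in_H[OF i c'(1)] c c' by metis
  let ?d = "expand (f i (\<not> e)) z"
  have d: "?d \<in> words X" "length ?d = length c'" using f_words' length_expand_f i z by blast+
  have "bval c = bval c'" using c c' by (intro bval_cong) (auto simp: geodesic_word_def)
  then have "\<sigma> i e \<cdot> bval c \<cdot> \<sigma> i (\<not> e) = bval ?d \<cdot> \<sigma> i e \<cdot> inv\<^bsub>G\<^esub> (\<sigma> i e)"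
    using stable_expand[OF i z(1)] z(2) \<sigma>_inv[OF i, of e] by simp
  also have "\<dots> = bval ?d" using d \<sigma>_closed[OF i] by (simp add: G.m_assoc)
  finally show ?thesis using d c'(3) by (metis)
qed

text \<open>Both stable letters disappear and the segment between them does not grow. The full gain
  of 2 matters: a geodesic of length \<open>N\<close> extended by a letter that creates a pinch
  drops below level \<open>N\<close>.\<close>

lemma pinch_lev:
  assumes w: "w \<in> words S" and pinch: "\<not> pinch_free w"
  shows "G.lev (G.val w) + 2 \<le> length w"
proof -
  obtain p i e c q where w_eq: "w = p @ [(Inr i, e)] @ base_word c @ [(Inr i, \<not> e)] @ q"
    and c: "c \<in> words X" "A.val c \<in> H i e"
    using pinch unfolding pinch_free_def by blast
  have pq: "p \<in> words S" "q \<in> words S" and i: "i \<in> {1..n}" using w w_eq by (auto simp: hnn_gens_def)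
  obtain d where d: "d \<in> words X" "length d \<le> length c" "\<sigma> i e \<cdot> bval c \<cdot> \<sigma> i (\<not> e) = bval d"
    using pinch_shortcut[OF i c] by blast
  let ?s = "[(Inr i, e)] @ base_word c @ [(Inr i, \<not> e)]"
  have sw: "?s \<in> words S" using stable_in_gens[OF i] c by simp
  have "G.val ?s = \<sigma> i e \<cdot> (bval c \<cdot> \<sigma> i (\<not> e))"
    using stable_in_gens[OF i] c by (subst G.val_append; simp add: G.val_append del: append_Cons)
  also have "\<dots> = bval d" using d(3) c \<sigma>_closed[OF i] by (simp add: G.m_assoc)
  finally have "G.val (?s @ q) = G.val (base_word d @ q)"
    using sw pq d by (simp add: G.val_append del: append_Cons append_assoc)
  then have "G.val (p @ (?s @ q)) = G.val (p @ (base_word d @ q))"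
    using sw pq d by (subst (1 2) G.val_append) (auto)
  then have "G.val w = G.val (p @ base_word d @ q)" using w_eq by simp
  moreover have "G.lev (G.val (p @ base_word d @ q)) \<le> length (p @ base_word d @ q)"
    using pq d by (intro G.lev_val) simp
  ultimately show ?thesis using d w_eq by simp
qed

lemma pinch_free_geodesic: "w \<in> words S \<Longrightarrow> G.lev (G.val w) = length w \<Longrightarrow> pinch_free w"
  using pinch_lev by fastforce

section \<open>Detours across a strip\<close>

lemma stable_cross:
  assumes i: "i \<in> {1..n}" and z: "z \<in> words {1..m i}" and p: "p \<in> carrier G"
    and q: "q = length (expand (f i e) (take k z))"
  shows "p \<cdot> \<sigma> i e \<cdot> bval (take q (expand (f i e) z)) = p \<cdot> bval (take q (expand (f i (\<not> e)) z)) \<cdot> \<sigma> i e"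
proof -
  have zk: "take k z \<in> words {1..m i}" using z by simp
  \<comment> \<open>Since corresponding generators have equal length, the same \<open>q\<close> is a
    boundary on both sides of the strip.\<close>
  have q': "q = length (expand (f i (\<not> e)) (take k z))" using length_expand_f[OF i zk] q by simp
  have t: "take q (expand (f i e) z) = expand (f i e) (take k z)"
    "take q (expand (f i (\<not> e)) z) = expand (f i (\<not> e)) (take k z)"
    by (simp add: q take_expand) (simp add: q' take_expand)
  show ?thesis
    using stable_expand[OF i zk, of e] f_words'[OF i zk] p \<sigma>_closed[OF i] by (simp add: t G.m_assoc)
qed

lemma conn_stable_edge:
  assumes "i \<in> {1..n}" "x \<in> carrier G" "G.lev x + 1 \<le> N"
  shows "G.conn N 1 x (x \<cdot> \<sigma> i e)"
proof (rule G.conn_edge)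
  show "fst (Inr i, e) \<in> S" using assms by (simp add: hnn_gens_def)
  show "G.lev x + G.lev (x \<cdot> \<sigma> i e) < 2 * N"
    using G.lev_mult[OF assms(2) stable_in_gens[OF assms(1)], of e] assms(3) by simp
qed (rule assms)

text \<open>At most \<open>M\<close> steps back along the near side reach the boundary
  \<open>q\<close>, and one stable edge follows. The slack in
  \<open>G.lev p + 1 \<le> \<alpha>\<close> puts the far end of that edge below level
  \<open>N\<close>.\<close>

lemma conn_strip_enter:
  assumes i: "i \<in> {1..n}" and z: "z \<in> words {1..m i}" and p: "p \<in> carrier G" "G.lev p + 1 \<le> \<alpha>"
    and q: "q = length (expand (f i e) (take k z))" "q \<le> r" "r \<le> q + M"
    and r: "r \<le> length (expand (f i e) z)" "\<alpha> + r \<le> N"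
  shows "G.conn N (M + 1) (p \<cdot> \<sigma> i e \<cdot> bval (take r (expand (f i e) z))) (p \<cdot> bval (take q (expand (f i (\<not> e)) z)))"
proof -
  let ?W = "expand (f i e) z" and ?W' = "expand (f i (\<not> e)) z" and ?P = "p \<cdot> \<sigma> i e"
  have W: "?W \<in> words X" "?W' \<in> words X" "length ?W' = length ?W"
    using f_words' length_expand_f i z by blast+
  have P: "?P \<in> carrier G" using p \<sigma>_closed[OF i] by simp
  have levP: "G.lev ?P \<le> \<alpha>"
    using G.lev_mult[OF p(1) stable_in_gens[OF i], of e] p(2) by simp
  have "G.conn N (r - q) (?P \<cdot> G.val (take q (base_word ?W))) (?P \<cdot> G.val (take r (base_word ?W)))"
    using P levP W q r by (intro G.conn_up) auto
  from G.conn_mono[OF G.conn_sym[OF this], where C' = M] have 1: "G.conn N M (?P \<cdot> bval (take r ?W)) (?P \<cdot> bval (take q ?W))"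
    using q by (simp add: take_base_word)
  let ?x = "p \<cdot> bval (take q ?W')"
  have x: "?x \<in> carrier G" using p W by simp
  have "G.lev ?x \<le> G.lev p + q"
    using G.lev_mult[OF p(1), of "base_word (take q ?W')"] W q r by simp
  then have "G.conn N 1 ?x (?x \<cdot> \<sigma> i e)" using x p q r by (intro conn_stable_edge i) auto
  then have "G.conn N 1 (?P \<cdot> bval (take q ?W)) ?x"
    using stable_cross[OF i z p(1) q(1)] G.conn_sym by simp
  with 1 show ?thesis by (rule G.conn_trans)
qed

text \<open>The counterpart of \<open>conn_strip_enter\<close> at the other end of the strip: the
  levels are now estimated from that end, through \<open>\<beta>\<close>.\<close>

lemma conn_strip_exit:
  assumes i: "i \<in> {1..n}" and z: "z \<in> words {1..m i}" and p: "p \<in> carrier G"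
    and \<beta>: "G.lev (p \<cdot> bval (expand (f i (\<not> e)) z)) + 1 \<le> \<beta>"
    and q: "q = length (expand (f i e) (take k z))" "t \<le> q" "q \<le> t + M"
    and t: "\<beta> + length (expand (f i e) z) \<le> N + t"
  shows "G.conn N (M + 1) (p \<cdot> bval (take q (expand (f i (\<not> e)) z))) (p \<cdot> \<sigma> i e \<cdot> bval (take t (expand (f i e) z)))"
proof -
  let ?W = "expand (f i e) z" and ?W' = "expand (f i (\<not> e)) z" and ?P = "p \<cdot> \<sigma> i e"
  have W: "?W \<in> words X" "?W' \<in> words X" "length ?W' = length ?W"
    using f_words' length_expand_f i z by blast+
  have P: "?P \<in> carrier G" using p \<sigma>_closed[OF i] by simp
  have qW: "q \<le> length ?W"
    unfolding q(1) by (rule length_expand_take_le)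
  let ?Q = "p \<cdot> bval ?W'"
  have Q: "?Q \<in> carrier G" using p W by simp
  have PW: "?P \<cdot> bval ?W = ?Q \<cdot> \<sigma> i e"
    using stable_expand[OF i z, of e] p W \<sigma>_closed[OF i] by (simp add: G.m_assoc)
  have "G.lev (?P \<cdot> bval ?W) \<le> \<beta>"
    using G.lev_mult[OF Q stable_in_gens[OF i], of e] \<beta> PW by simp
  then have "G.conn N (q - t) (?P \<cdot> G.val (take t (base_word ?W))) (?P \<cdot> G.val (take q (base_word ?W)))"
    using P W q t qW by (intro G.conn_down) auto
  from G.conn_mono[OF G.conn_sym[OF this], where C' = M] have 1: "G.conn N M (?P \<cdot> bval (take q ?W)) (?P \<cdot> bval (take t ?W))"
    using q by (simp add: take_base_word)
  let ?x = "p \<cdot> bval (take q ?W')"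
  have x: "?x \<in> carrier G" using p W by simp
  have "?x \<cdot> bval (drop q ?W') = ?Q"
    using bval_append[of "take q ?W'" "drop q ?W'"] p W by (simp add: G.m_assoc)
  then have "G.lev ?x \<le> G.lev ?Q + (length ?W - q)"
    using G.lev_mult_back[OF x, of "base_word (drop q ?W')"] W by simp
  then have "G.conn N 1 ?x (?x \<cdot> \<sigma> i e)"
    using x q t qW \<beta> by (intro conn_stable_edge i) auto
  then have "G.conn N 1 ?x (?P \<cdot> bval (take q ?W))" using stable_cross[OF i z p q(1)] by simp
  from G.conn_trans[OF this 1] show ?thesis by (simp add: add.commute)
qed

text \<open>Each crossing costs \<open>M + 1\<close>, and rounding to boundaries lengthens the
  middle part by at most \<open>2 * M\<close>. On the far side the corridor is used with
  \<open>\<alpha> - 1\<close> and \<open>\<beta> - 1\<close>, which is where the 2 in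
  \<open>len\<close> goes.\<close>

lemma conn_strip:
  assumes i: "i \<in> {1..n}" and z: "z \<in> words {1..m i}" and W: "W = expand (f i e) z"
    and p: "p \<in> carrier G" "G.lev p + 1 \<le> \<alpha>"
    and \<beta>: "G.lev (p \<cdot> bval (expand (f i (\<not> e)) z)) + 1 \<le> \<beta>"
    and M: "\<And>j. j \<in> {1..m i} \<Longrightarrow> length (f i e j) \<le> M"
    and len: "\<alpha> + \<beta> + length W \<le> 2 * N + 2"
    and rt: "r \<le> t" "t \<le> length W" "\<alpha> + r \<le> N" "\<beta> + length W \<le> N + t"
  shows "G.conn N (t - r + (4 * M + 2)) (p \<cdot> \<sigma> i e \<cdot> bval (take r W)) (p \<cdot> \<sigma> i e \<cdot> bval (take t W))"
proof -
  let ?W' = "expand (f i (\<not> e)) z"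
  have W': "?W' \<in> words X" "length ?W' = length W"
    using f_words' length_expand_f i z W by blast+
  obtain k k' where k: "k \<le> k'" "length (expand (f i e) (take k z)) \<le> r" "r \<le> length (expand (f i e) (take k z)) + M"
    "t \<le> length (expand (f i e) (take k' z))" "length (expand (f i e) (take k' z)) \<le> t + M"
    using expand_blocks_around[OF z, of "f i e" M r t] M rt W by blast
  define q where "q = length (expand (f i e) (take k z))"
  define q' where "q' = length (expand (f i e) (take k' z))"
  have qq': "q \<le> q'" unfolding q_def q'_def using length_expand_take_mono k(1) by blast
  have q'W: "q' \<le> length W"
    unfolding q'_def W by (rule length_expand_take_le)
  have 1: "G.conn N (M + 1) (p \<cdot> \<sigma> i e \<cdot> bval (take r W)) (p \<cdot> bval (take q ?W'))"
    unfolding W using rt W p k(2,3) by (intro conn_strip_enter[OF i z _ _ q_def]) (auto simp: q_def)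
  have 3: "G.conn N (M + 1) (p \<cdot> bval (take q' ?W')) (p \<cdot> \<sigma> i e \<cdot> bval (take t W))"
    unfolding W using rt W p \<beta> k(4,5) by (intro conn_strip_exit[OF i z _ _ q'_def]) (auto simp: q'_def)
  have "G.conn N (q' - q) (p \<cdot> G.val (take q (base_word ?W'))) (p \<cdot> G.val (take q' (base_word ?W')))"
    using p \<beta> W' len qq' q'W by (intro G.conn_corridor[of p "\<alpha> - 1" _ "\<beta> - 1"]) auto
  moreover have "q' - q \<le> t - r + 2 * M"
    using k(3,5) rt(1) unfolding q_def[symmetric] q'_def[symmetric] by linarith
  ultimately have 2: "G.conn N (t - r + 2 * M) (p \<cdot> bval (take q ?W')) (p \<cdot> bval (take q' ?W'))"
    using G.conn_mono by (simp add: take_base_word)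
  from G.conn_mono[OF G.conn_trans[OF G.conn_trans[OF 1 2] 3]] show ?thesis by simp
qed

text \<open>A path \<open>W\<close> in a translate of the base group, with ends of level at most \<open>\<alpha>\<close> and \<open>\<beta>\<close>, leaves the
  ball of radius \<open>N\<close> only if its length exceeds \<open>2 * N - \<alpha> - \<beta>\<close>. Each application of the falsification
  property lowers the excess \<open>c\<close>; as soon as the path is geodesic, \<open>geodesic\<close> gives a detour.\<close>

lemma conn_fellow_travel:
  assumes fft: "A.vertex_fellow_traveler K"
    and P: "P \<in> carrier G" "G.lev P \<le> \<alpha>"
    and geodesic: "\<And>W r t. geodesic_word A \<iota>A X W \<Longrightarrow> A.val W = h \<Longrightarrow> \<alpha> + \<beta> + length W \<le> 2 * N + 2 \<Longrightarrow>
      r \<le> t \<Longrightarrow> t \<le> length W \<Longrightarrow> \<alpha> + r \<le> N \<Longrightarrow> \<beta> + length W \<le> N + t \<Longrightarrow>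
      G.conn N (t - r + D) (P \<cdot> bval (take r W)) (P \<cdot> bval (take t W))"
    and "W \<in> words X" "A.val W = h" "G.lev (P \<cdot> bval W) \<le> \<beta>"
    and "c \<le> 2" "\<alpha> + \<beta> + length W \<le> 2 * N + c"
    and "r \<le> t" "t \<le> length W" "\<alpha> + r \<le> N" "\<beta> + length W \<le> N + t"
  shows "G.conn N (t - r + D + 6 * K * c) (P \<cdot> bval (take r W)) (P \<cdot> bval (take t W))"
  using assms(5-)
proof (induction c arbitrary: W r t)
  case 0
  then have "G.conn N (t - r) (P \<cdot> G.val (take r (base_word W))) (P \<cdot> G.val (take t (base_word W)))"
    using P by (intro G.conn_corridor[of P \<alpha> _ \<beta>]) auto
  then show ?case by (auto simp: take_base_word intro: G.conn_mono)
next
  case (Suc c)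
  show ?case
  proof (cases "geodesic_word A \<iota>A X W")
    case True
    have "\<alpha> + \<beta> + length W \<le> 2 * N + 2" using Suc.prems by simp
    from geodesic[OF True Suc.prems(2) this Suc.prems(6-9)] show ?thesis
      by (rule G.conn_mono) simp
  next
    case False
    with fft Suc.prems(1) obtain u where u: "u \<in> words X" "length u < length W" "A.val u = A.val W"
      and near: "\<And>i. A.gdist (A.val (take i W)) (A.val (take i u)) \<le> K"
      unfolding A.vertex_fellow_traveler_def by blast
    have bval_u: "bval u = bval W" using u Suc.prems by (intro bval_cong) auto
    have dist: "G.gdist (P \<cdot> bval (take i W)) (P \<cdot> bval (take i u)) \<le> K" for i
      using gdist_bval_le[OF P(1), of "take i W" "take i u"] near[of i] u Suc.prems(1) by simp
    have closed: "P \<cdot> bval (take i W) \<in> carrier G" "P \<cdot> bval (take i u) \<in> carrier G" for i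
      using P u Suc.prems(1) by simp_all
    define r0 where "r0 = r - K"
    define t0 where "t0 = min (t + K) (length W)"
    have r0: "r0 \<le> r" "r \<le> r0 + K" and t0: "t \<le> t0" "t0 \<le> t + K" "t0 \<le> length W"
      using Suc.prems by (auto simp: r0_def t0_def)
    have "G.conn N (r - r0) (P \<cdot> G.val (take r0 (base_word W))) (P \<cdot> G.val (take r (base_word W)))"
      using P Suc.prems r0 by (intro G.conn_up) auto
    from G.conn_mono[OF G.conn_sym[OF this], where C' = K] have 1: "G.conn N K (P \<cdot> bval (take r W)) (P \<cdot> bval (take r0 W))"
      using r0 by (simp add: take_base_word)
    have 2: "G.conn N K (P \<cdot> bval (take r0 W)) (P \<cdot> bval (take r0 u))"
    proof (cases "r0 = 0")
      case False
      have "G.lev (P \<cdot> bval (take r0 W)) \<le> \<alpha> + r0"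
        using G.lev_mult[OF P(1), of "base_word (take r0 W)"] P(2) Suc.prems r0 by simp
      moreover have "r = r0 + K" using False by (simp add: r0_def)
      ultimately show ?thesis
        using closed dist Suc.prems by (intro G.conn_free_path_le) auto
    qed auto
    \<comment> \<open>The word \<open>u\<close> is shorter than \<open>W\<close>, so the positions
      may lie beyond its end; truncating them does not change the vertices.\<close>
    define r1 where "r1 = min r0 (length u)"
    define t1 where "t1 = min t0 (length u)"
    have take_u: "take r1 u = take r0 u" "take t1 u = take t0 u"
      by (simp_all add: r1_def t1_def min_def)
    have "G.conn N (t1 - r1 + D + 6 * K * c) (P \<cdot> bval (take r1 u)) (P \<cdot> bval (take t1 u))"
    proof (rule Suc.IH)
      show "\<beta> + length u \<le> N + t1"
        using Suc.prems u t0 by (auto simp: t1_def t0_def min_def split: if_splits)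
      show "r1 \<le> t1" using Suc.prems r0 t0 by (auto simp: r1_def t1_def)
    qed (use Suc.prems u bval_u r0 in \<open>auto simp: r1_def t1_def\<close>)
    moreover have "t1 - r1 \<le> t - r + 2 * K"
    proof (cases "r0 \<le> length u")
      case True
      then have "r1 = r0" "t1 \<le> t0" by (simp_all add: r1_def t1_def)
      then show ?thesis using r0(2) t0(2) \<open>r \<le> t\<close> by linarith
    qed (simp add: r1_def t1_def)
    ultimately have 3: "G.conn N (t - r + 2 * K + D + 6 * K * c) (P \<cdot> bval (take r0 u)) (P \<cdot> bval (take t0 u))"
      unfolding take_u
      using G.conn_mono[of N "t1 - r1 + D + 6 * K * c" _ _ "t - r + 2 * K + D + 6 * K * c"] by simp
    have W_split: "P \<cdot> bval W = P \<cdot> bval (take t0 W) \<cdot> bval (drop t0 W)"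
      using bval_append[of "take t0 W" "drop t0 W"] P Suc.prems by (simp add: G.m_assoc)
    have 4: "G.conn N K (P \<cdot> bval (take t0 W)) (P \<cdot> bval (take t0 u))"
    proof (cases "t0 = length W")
      case True
      then show ?thesis using u bval_u by simp
    next
      case False
      then have t0': "t0 = t + K" by (simp add: t0_def min_def split: if_splits)
      have "G.lev (P \<cdot> bval (take t0 W)) \<le> \<beta> + (length W - t0)"
        using G.lev_mult_back[OF closed(1), of "base_word (drop t0 W)" t0] W_split Suc.prems by simp
      then show ?thesis
        using closed dist Suc.prems t0 t0' by (intro G.conn_free_path_le) auto
    qed
    have "G.conn N (t0 - t) (P \<cdot> G.val (take t (base_word W))) (P \<cdot> G.val (take t0 (base_word W)))"
      using P Suc.prems t0 by (intro G.conn_down) auto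
    from G.conn_mono[OF G.conn_sym[OF this], where C' = K] have 5: "G.conn N K (P \<cdot> bval (take t0 W)) (P \<cdot> bval (take t W))"
      using t0 by (simp add: take_base_word)
    \<comment> \<open>Two retreats and two jumps cost \<open>4 * K\<close>, and the middle part is
      longer by at most \<open>2 * K\<close>; hence \<open>6 * K\<close> for each unit of
      excess.\<close>
    show ?thesis
      using G.conn_mono[OF G.conn_trans[OF G.conn_trans[OF G.conn_trans[OF G.conn_trans[OF 1 2] 3]
        G.conn_sym[OF 4]] 5]] by simp
  qed
qed

section \<open>Almost convexity\<close>

text \<open>The constant collects \<open>length \<gamma> \<le> 2\<close>, the
  \<open>4 * M + 2\<close> of a strip and \<open>6 * K\<close> for each of at most two
  reductions.\<close>

lemma conn_same_coset:
  assumes fft: "A.vertex_fellow_traveler K"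
    and M: "\<And>i j e. i \<in> {1..n} \<Longrightarrow> j \<in> {1..m i} \<Longrightarrow> length (f i e j) \<le> M"
    and w: "w \<in> words S" "length w = N" "G.lev (G.val w) = N"
    and w': "w' \<in> words S" "length w' = N" "G.lev (G.val w') = N"
    and \<gamma>: "\<gamma> \<in> words X" "length \<gamma> \<le> 2" "G.val w \<cdot> bval \<gamma> = G.val w'"
  shows "G.conn N (4 * M + 4 + 12 * K) (G.val w) (G.val w')"
proof -
  have pf: "pinch_free w" "pinch_free w'" using w w' by (auto intro: pinch_free_geodesic)
  have st: "state (w @ base_word \<gamma>) = state w'"
    using w w' \<gamma> by (intro state_cong) (auto simp: G.val_append)
  show ?thesis
    using w(1)
  proof (cases rule: words_cases_last_stable)
    \<comment> \<open>There is no stable letter and hence no strip: \<open>W\<close> is a loop at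
      the identity, and the only geodesic word for it is empty. This allows
      \<open>\<alpha> = \<beta> = 0\<close>.\<close>
    case (base c)
    have st_w: "state (w @ base_word \<gamma>) = ([], A.val c \<otimes>\<^bsub>A\<^esub> A.val \<gamma>)"
      using state_append_base_word[of w "[]" "A.val c" \<gamma>] state_base_word base \<gamma> by simp
    obtain c' where c': "c' \<in> words X" "w' = base_word c'"
      using w'(1)
    proof (cases rule: words_cases_last_stable)
      case (stable p i e c')
      with state_pinch_free[of p i e c'] pf st st_w show ?thesis by auto
    qed
    define W where "W = c @ \<gamma> @ word_inv c'"
    have W: "W \<in> words X" "length W = N + length \<gamma> + N"
      using base c' \<gamma> w w' by (simp_all add: W_def)
    have "A.val c \<otimes>\<^bsub>A\<^esub> A.val \<gamma> = A.val c'" using st st_w state_base_word c' by simp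
    then have val_W: "A.val W = \<one>\<^bsub>A\<^esub>"
      using base c' \<gamma> by (simp add: W_def A.val_append A.val_word_inv A.m_assoc[symmetric])
    have "bval W = bval []" using W val_W by (intro bval_cong) auto
    then have "bval W = \<one>\<^bsub>G\<^esub>" by simp
    moreover have "G.lev \<one>\<^bsub>G\<^esub> \<le> 0" using G.lev_val[of "[]"] by simp
    ultimately have "G.conn N (N + length \<gamma> - N + (4 * M + 2) + 6 * K * 2)
        (\<one>\<^bsub>G\<^esub> \<cdot> bval (take N W)) (\<one>\<^bsub>G\<^esub> \<cdot> bval (take (N + length \<gamma>) W))"
      using W val_W \<gamma> w w'
    proof (intro conn_fellow_travel[OF fft, where \<alpha> = 0 and \<beta> = 0 and h = "\<one>\<^bsub>A\<^esub>"])
      fix W' r t assume "geodesic_word A \<iota>A X W'" "A.val W' = \<one>\<^bsub>A\<^esub>"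
      then have "W' = []" unfolding geodesic_word_def by (metis word_val.simps(1) length_greater_0_conv list.size(3) words_Nil)
      then show "G.conn N (t - r + (4 * M + 2)) (\<one>\<^bsub>G\<^esub> \<cdot> bval (take r W')) (\<one>\<^bsub>G\<^esub> \<cdot> bval (take t W'))" by simp
    qed auto
    moreover have "bval (take N W) = G.val w" using base w by (simp add: W_def)
    moreover have "bval (take (N + length \<gamma>) W) = G.val w'"
      using base w \<gamma> by (simp add: W_def bval_append)
    ultimately have "G.conn N (length \<gamma> + (4 * M + 2) + 6 * K * 2) (G.val w) (G.val w')"
      using w w' by simp
    then show ?thesis by (rule G.conn_mono) (use \<gamma> in simp)
  next
    case (stable p i e c)
    obtain L r h where h: "h \<in> H i e" "state w = (((i, e), r) # L, h \<otimes>\<^bsub>A\<^esub> A.val c)"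
      using state_pinch_free[of p i e c] stable pf by metis
    have hc: "h \<in> carrier A" using h B.H_carrier stable by blast
    have st_w: "state (w @ base_word \<gamma>) = (((i, e), r) # L, h \<otimes>\<^bsub>A\<^esub> A.val c \<otimes>\<^bsub>A\<^esub> A.val \<gamma>)"
      using state_append_base_word[OF h(2)] hc stable \<gamma> by simp
    obtain p' c' h' where p': "p' \<in> words S" "c' \<in> words X" "w' = p' @ [(Inr i, e)] @ base_word c'"
      "h' \<in> H i e" "h \<otimes>\<^bsub>A\<^esub> A.val c \<otimes>\<^bsub>A\<^esub> A.val \<gamma> = h' \<otimes>\<^bsub>A\<^esub> A.val c'"
      using w'(1)
    proof (cases rule: words_cases_last_stable)
      case (base c')
      then show ?thesis using state_base_word st st_w by simp
    next
      case (stable p' i' e' c')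
      obtain L' r' h' where h': "h' \<in> H i' e'" "state w' = (((i', e'), r') # L', h' \<otimes>\<^bsub>A\<^esub> A.val c')"
        using state_pinch_free[of p' i' e' c'] stable pf by metis
      with st st_w stable that show ?thesis by auto
    qed
    have h'c: "h' \<in> carrier A" using p' B.H_carrier stable by blast
    define W where "W = c @ \<gamma> @ word_inv c'"
    have W: "W \<in> words X" "length W = length c + length \<gamma> + length c'"
      using stable p' \<gamma> by (simp_all add: W_def)
    \<comment> \<open>The factors \<open>h\<close> and \<open>h'\<close> are left over from the
      normal forms and otherwise unknown. Both lie in \<open>H i e\<close>, and \<open>W\<close>
      differs by them only.\<close>
    have "h \<otimes>\<^bsub>A\<^esub> A.val W = (h \<otimes>\<^bsub>A\<^esub> A.val c \<otimes>\<^bsub>A\<^esub> A.val \<gamma>) \<otimes>\<^bsub>A\<^esub> A.val (word_inv c')"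
      using stable(3) p'(2) \<gamma>(1) hc by (simp add: W_def A.val_append A.m_assoc)
    also have "\<dots> = h'" unfolding p'(5) using p' h'c by (simp add: A.val_word_inv A.m_assoc)
    finally have "A.val W \<in> H i e"
      using B.H_mult_left_iff[of i h e "A.val W"] h p' W stable by simp
    \<comment> \<open>With these values the vertex of \<open>w\<close> at position
      \<open>length c\<close> of \<open>W\<close> is reached from \<open>?P\<close> with bound
      exactly \<open>N\<close>, that of \<open>w'\<close> likewise from the other end. So the excess
      of \<open>W\<close> is just \<open>length \<gamma>\<close>.\<close>
    define \<alpha> where "\<alpha> = length p + 1"
    define \<beta> where "\<beta> = length p' + 1"
    have \<alpha>: "\<alpha> + length c = N" and \<beta>: "\<beta> + length c' = N"
      using stable p' w w' by (auto simp: \<alpha>_def \<beta>_def)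
    have lev: "G.lev (G.val p) + 1 \<le> \<alpha>" "G.lev (G.val p') + 1 \<le> \<beta>"
      using G.lev_val stable p' by (auto simp: \<alpha>_def \<beta>_def)
    have s: "\<sigma> i e \<in> carrier G" using \<sigma>_closed stable by blast
    let ?P = "G.val p \<cdot> \<sigma> i e"
    have P: "?P \<in> carrier G" using stable s by simp
    have levP: "G.lev ?P \<le> \<alpha>"
      using G.lev_mult[of "G.val p" "[(Inr i, e)]"] stable_in_gens[of i e] stable lev by simp
    have val_w: "G.val w = ?P \<cdot> bval c" using val_append_stable stable by simp
    have val_w': "G.val w' = G.val p' \<cdot> \<sigma> i e \<cdot> bval c'" using val_append_stable p' stable by simp
    have end1: "?P \<cdot> bval (c @ \<gamma>) = G.val w'"
      using \<gamma> val_w P stable by (simp add: bval_append G.m_assoc)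
    have "?P \<cdot> bval W = (?P \<cdot> bval (c @ \<gamma>)) \<cdot> bval (word_inv c')"
      using P stable \<gamma> p' by (simp add: W_def bval_append G.m_assoc)
    also have "\<dots> = G.val p' \<cdot> \<sigma> i e"
      unfolding end1 val_w' using p' s by (simp add: bval_word_inv G.m_assoc)
    finally have end2: "?P \<cdot> bval W = G.val p' \<cdot> \<sigma> i e" .
    have levQ: "G.lev (?P \<cdot> bval W) \<le> \<beta>"
      unfolding end2 using G.lev_mult[of "G.val p'" "[(Inr i, e)]"] stable_in_gens[of i e] stable p' lev by simp
    have "G.conn N (length c + length \<gamma> - length c + (4 * M + 2) + 6 * K * 2)
        (?P \<cdot> bval (take (length c) W)) (?P \<cdot> bval (take (length c + length \<gamma>) W))"
    proof (rule conn_fellow_travel[OF fft P levP _ W(1) HOL.refl levQ])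
      fix W' r t
      assume W': "geodesic_word A \<iota>A X W'" "A.val W' = A.val W" "\<alpha> + \<beta> + length W' \<le> 2 * N + 2"
        and rt: "r \<le> t" "t \<le> length W'" "\<alpha> + r \<le> N" "\<beta> + length W' \<le> N + t"
      obtain z where z: "z \<in> words {1..m i}" "W' = expand (f i e) z"
        using geodesic_in_H[of i W' e] W' \<open>A.val W \<in> H i e\<close> stable by auto
      have "bval W' = bval W" using W' W by (intro bval_cong) (auto simp: geodesic_word_def)
      \<comment> \<open>Cancelling the stable letter identifies the end of the far side as
        \<open>p'\<close>, which supplies the bound with \<open>\<beta>\<close> that
        \<open>conn_strip\<close> asks for.\<close>
      then have "G.val p \<cdot> bval (expand (f i (\<not> e)) z) \<cdot> \<sigma> i e = G.val p' \<cdot> \<sigma> i e"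
        using end2 stable_expand[of i z e] z stable f_words'[of i z "\<not> e"] s W(1)
        by (simp add: G.m_assoc)
      then have "G.val p \<cdot> bval (expand (f i (\<not> e)) z) = G.val p'"
        using s stable p' z f_words'[of i z "\<not> e"] by (simp add: G.right_cancel)
      then show "G.conn N (t - r + (4 * M + 2)) (?P \<cdot> bval (take r W')) (?P \<cdot> bval (take t W'))"
        using z W' rt lev stable M
        by (intro conn_strip[of i z W' e "G.val p" \<alpha> \<beta> M N r t]) auto
    qed (use W \<alpha> \<beta> \<gamma> in auto)
    moreover have "?P \<cdot> bval (take (length c) W) = G.val w" using val_w by (simp add: W_def)
    moreover have "?P \<cdot> bval (take (length c + length \<gamma>) W) = G.val w'" using end1 by (simp add: W_def)
    ultimately have "G.conn N (length \<gamma> + (4 * M + 2) + 6 * K * 2) (G.val w) (G.val w')" by simp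
    then show ?thesis by (rule G.conn_mono) (use \<gamma> in simp)
  qed
qed

section \<open>Edges labelled by stable letters\<close>

lemma state_append_stable_pinch_free:
  assumes "w \<in> words S" "i \<in> {1..n}" "pinch_free (w @ [(Inr i, e)])"
  obtains L r h where "h \<in> H i e" "state (w @ [(Inr i, e)]) = (((i, e), r) # L, h)"
proof -
  obtain L r h where "h \<in> H i e" "state (w @ [(Inr i, e)] @ base_word []) = (((i, e), r) # L, h \<otimes>\<^bsub>A\<^esub> A.val [])"
    using state_pinch_free[of w i e "[]"] assms by fastforce
  moreover from this have "h \<in> carrier A" using B.H_carrier assms by blast
  ultimately show thesis using that by simp
qed

text \<open>A pinch in \<open>w @ [(Inr i, e)]\<close> would bring \<open>w'\<close> below level
  \<open>N\<close>. Without one, comparing states shows that \<open>w'\<close> ends in the same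
  stable letter followed by an element of \<open>H i e\<close>; then \<open>w'\<close> extended by
  the inverse letter has a pinch, and \<open>w\<close> falls below level \<open>N\<close>.\<close>

lemma stable_edge_changes_level:
  assumes w: "w \<in> words S" "length w = N" "G.lev (G.val w) = N"
    and w': "w' \<in> words S" "length w' = N" "G.lev (G.val w') = N"
    and i: "i \<in> {1..n}" and eq: "G.val (w @ [(Inr i, e)]) = G.val w'"
  shows False
proof -
  have ws: "w @ [(Inr i, e)] \<in> words S" using w stable_in_gens[OF i] by simp
  have pf: "pinch_free (w @ [(Inr i, e)])"
  proof (rule ccontr)
    assume "\<not> pinch_free (w @ [(Inr i, e)])"
    from pinch_lev[OF ws this] show False using eq w w' by simp
  qed
  have pf': "pinch_free w'" using w' by (intro pinch_free_geodesic) auto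
  obtain L r h where h: "h \<in> H i e" "state (w @ [(Inr i, e)]) = (((i, e), r) # L, h)"
    using state_append_stable_pinch_free[OF w(1) i pf] by blast
  have st: "state (w @ [(Inr i, e)]) = state w'" using ws w' eq by (intro state_cong)
  show False
    using w'(1)
  proof (cases rule: words_cases_last_stable)
    case (base c)
    then show ?thesis using h st state_base_word by simp
  next
    case (stable p' i' e' c')
    obtain L' r' h' where h': "h' \<in> H i' e'" "state w' = (((i', e'), r') # L', h' \<otimes>\<^bsub>A\<^esub> A.val c')"
      using state_pinch_free[of p' i' e' c'] stable pf' by metis
    then have ie: "i' = i" "e' = e" "h = h' \<otimes>\<^bsub>A\<^esub> A.val c'" using h st by auto
    then have "A.val c' \<in> H i e" using B.H_mult_left_iff[of i h' e "A.val c'"] h h' stable i by simp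
    moreover have "w' @ [(Inr i, \<not> e)] = p' @ [(Inr i, e)] @ base_word c' @ [(Inr i, \<not> e)] @ []"
      using stable ie by simp
    ultimately have np: "\<not> pinch_free (w' @ [(Inr i, \<not> e)])"
      unfolding pinch_free_def using stable(3) by blast
    have s: "\<sigma> i e \<in> carrier G" using \<sigma>_closed[OF i] .
    have "G.val (w' @ [(Inr i, \<not> e)]) = G.val w' \<cdot> inv\<^bsub>G\<^esub> (\<sigma> i e)"
      using w' stable_in_gens[OF i] \<sigma>_inv[OF i] by (simp add: G.val_append)
    also have "G.val w' = G.val w \<cdot> \<sigma> i e"
      using eq w stable_in_gens[OF i] by (simp add: G.val_append)
    also have "G.val w \<cdot> \<sigma> i e \<cdot> inv\<^bsub>G\<^esub> (\<sigma> i e) = G.val w"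
      using w s by (simp add: G.m_assoc)
    finally have "G.lev (G.val (w' @ [(Inr i, \<not> e)])) = N" using w by simp
    moreover have "w' @ [(Inr i, \<not> e)] \<in> words S" using w' stable_in_gens[OF i] by simp
    ultimately show ?thesis using pinch_lev[of "w' @ [(Inr i, \<not> e)]"] np w' by simp
  qed
qed

text \<open>Comparing states makes the end \<open>c'\<close> of \<open>w'\<close> together with
  \<open>b\<close> a word in \<open>H i e\<close>, one side of a strip whose other side ends at
  \<open>w\<close>. Crossing costs \<open>M + 1\<close>, and at most \<open>M + 1\<close> further
  letters lead to \<open>w\<close>.\<close>

lemma conn_peak_stable_base:
  assumes M: "\<And>i j e. i \<in> {1..n} \<Longrightarrow> j \<in> {1..m i} \<Longrightarrow> length (f i e j) \<le> M"
    and w: "w \<in> words S" "length w = N" "G.lev (G.val w) = N"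
    and w': "w' \<in> words S" "length w' = N" "G.lev (G.val w') = N"
    and i: "i \<in> {1..n}" and b: "fst b \<in> X"
    and eq: "G.val (w @ [(Inr i, e)]) = G.val (w' @ base_word [b])"
    and peak: "G.lev (G.val (w @ [(Inr i, e)])) = N + 1"
  shows "G.conn N (2 * M + 2) (G.val w) (G.val w')"
proof -
  have ws: "w @ [(Inr i, e)] \<in> words S" using w stable_in_gens[OF i] by simp
  have bX: "[b] \<in> words X" using b by simp
  have pf: "pinch_free (w @ [(Inr i, e)])" using ws peak w by (intro pinch_free_geodesic) auto
  have pf': "pinch_free w'" using w' by (intro pinch_free_geodesic) auto
  obtain L r h where h: "h \<in> H i e" "state (w @ [(Inr i, e)]) = (((i, e), r) # L, h)"
    using state_append_stable_pinch_free[OF w(1) i pf] by blast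
  have "w' @ base_word [b] \<in> words S" using w' bX base_word_in_words by (simp del: words_Cons)
  with ws eq have st: "state (w @ [(Inr i, e)]) = state (w' @ base_word [b])" by (intro state_cong)
  show ?thesis
    using w'(1)
  proof (cases rule: words_cases_last_stable)
    case (base c)
    then have "state (w' @ base_word [b]) = ([], A.val c \<otimes>\<^bsub>A\<^esub> A.val [b])"
      using state_append_base_word[of w' "[]" "A.val c" "[b]"] state_base_word bX by simp
    then show ?thesis using h st by simp
  next
    case (stable p' i' e' c')
    obtain L' r' h' where h': "h' \<in> H i' e'" "state w' = (((i', e'), r') # L', h' \<otimes>\<^bsub>A\<^esub> A.val c')"
      using state_pinch_free[of p' i' e' c'] stable pf' by metis
    have h'c: "h' \<in> carrier A" using h' B.H_carrier stable by blast
    define W where "W = c' @ [b]"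
    have W: "W \<in> words X" "length W = length c' + 1" using stable bX by (simp_all add: W_def)
    have "state (w' @ base_word [b]) = (((i', e'), r') # L', h' \<otimes>\<^bsub>A\<^esub> A.val c' \<otimes>\<^bsub>A\<^esub> A.val [b])"
      using state_append_base_word[OF h'(2), of "[b]"] h'c stable bX by simp
    then have ie: "i' = i" "e' = e" and "h = h' \<otimes>\<^bsub>A\<^esub> A.val c' \<otimes>\<^bsub>A\<^esub> A.val [b]"
      using h st by auto
    then have "h = h' \<otimes>\<^bsub>A\<^esub> A.val W"
      using h'c stable bX A.val_closed[OF bX] by (simp add: W_def A.val_append A.m_assoc)
    then have WH: "A.val W \<in> H i e"
      using B.H_mult_left_iff[of i h' e "A.val W"] h h' ie W i by simp
    let ?p = "G.val p'"
    have p: "?p \<in> carrier G" and s: "\<sigma> i e \<in> carrier G" using stable \<sigma>_closed[OF i] by simp_all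
    have end1: "G.val (w' @ base_word [b]) = ?p \<cdot> \<sigma> i e \<cdot> bval W"
      using val_append_stable[of p' i W e] stable ie W by (simp add: W_def base_word_append)
    have N: "length p' + length W = N" using stable w' W by simp
    \<comment> \<open>A shorter word in place of \<open>W\<close> would give the peak a level of at
      most \<open>N\<close>, so fellow travelers are not called for here.\<close>
    have "geodesic_word A \<iota>A X W"
    proof (rule ccontr)
      assume "\<not> geodesic_word A \<iota>A X W"
      then obtain d where d: "d \<in> words X" "A.val d = A.val W" "length d < length W"
        using W by (auto simp: geodesic_word_def)
      have "G.val (p' @ [(Inr i, e)] @ base_word d) = G.val (w @ [(Inr i, e)])"
        using val_append_stable[of p' i d e] bval_cong[of d W] d W stable end1 eq i by simp
      then have "G.lev (G.val (w @ [(Inr i, e)])) \<le> length (p' @ [(Inr i, e)] @ base_word d)"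
        using G.lev_val[of "p' @ [(Inr i, e)] @ base_word d"] stable d stable_in_gens[OF i, of e] by simp
      then show False using peak d N by simp
    qed
    then obtain z where z: "z \<in> words {1..m i}" "W = expand (f i e) z"
      using geodesic_in_H[OF i] WH by blast
    let ?W' = "expand (f i (\<not> e)) z"
    have W': "?W' \<in> words X" "length ?W' = length W"
      using f_words' length_expand_f i z by blast+
    have "G.val w \<cdot> \<sigma> i e = ?p \<cdot> bval ?W' \<cdot> \<sigma> i e"
      using eq end1 stable_expand[OF i z(1), of e] z W' w p s stable_in_gens[OF i] f_words'[OF i z(1), of e]
      by (simp add: G.val_append G.m_assoc)
    then have val_w: "G.val w = ?p \<cdot> bval ?W'" using w p s W' by (simp add: G.right_cancel)
    have val_w': "G.val w' = ?p \<cdot> \<sigma> i e \<cdot> bval (take (length c') W)"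
      using val_append_stable[of p' i c' e] stable ie by (simp add: W_def)
    obtain k where k: "length (expand (f i e) (take k z)) \<le> length c'"
        "length c' \<le> length (expand (f i e) (take k z)) + M"
      using expand_block_below[OF z(1), of "f i e" M "length c'"] M i W z by auto
    define q where "q = length (expand (f i e) (take k z))"
    have lev: "G.lev ?p \<le> length p'" using G.lev_val stable by simp
    have "G.conn N (M + 1) (?p \<cdot> \<sigma> i e \<cdot> bval (take (length c') W)) (?p \<cdot> bval (take q ?W'))"
      unfolding z(2) using k lev N W p z(2)
      by (intro conn_strip_enter[OF i z(1) _ _ q_def, where \<alpha> = "length p' + 1"]) (auto simp: q_def)
    moreover have "G.conn N (length W - q) (?p \<cdot> G.val (take q (base_word ?W'))) (?p \<cdot> G.val (take (length W) (base_word ?W')))"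
      using p lev N W W' k by (intro G.conn_up) (auto simp: q_def)
    ultimately have "G.conn N (M + 1 + (length W - q)) (G.val w') (G.val w)"
      using val_w val_w' W' by (auto simp: take_base_word intro: G.conn_trans)
    then have "G.conn N (2 * M + 2) (G.val w') (G.val w)"
      by (rule G.conn_mono) (use k W in \<open>simp add: q_def\<close>)
    then show ?thesis by (rule G.conn_sym)
  qed
qed

text \<open>Both extended words are geodesic, hence pinch-free, and their common state has only one
  top letter. The two stable letters agree and cancel.\<close>

lemma peak_stable_stable:
  assumes w: "w \<in> words S" "length w = N" and w': "w' \<in> words S" "length w' = N"
    and i: "i \<in> {1..n}" and i': "i' \<in> {1..n}"
    and eq: "G.val (w @ [(Inr i, e)]) = G.val (w' @ [(Inr i', e')])"
    and peak: "G.lev (G.val (w @ [(Inr i, e)])) = N + 1"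
  shows "G.val w = G.val w'"
proof -
  have ws: "w @ [(Inr i, e)] \<in> words S" "w' @ [(Inr i', e')] \<in> words S"
    using w w' stable_in_gens i i' by simp_all
  have "pinch_free (w @ [(Inr i, e)])" "pinch_free (w' @ [(Inr i', e')])"
    using ws peak eq w w' by (auto intro!: pinch_free_geodesic)
  then obtain L r h L' r' h' where "state (w @ [(Inr i, e)]) = (((i, e), r) # L, h)"
      "state (w' @ [(Inr i', e')]) = (((i', e'), r') # L', h')"
    using state_append_stable_pinch_free[of w i e] state_append_stable_pinch_free[of w' i' e'] w w' i i'
    by metis
  with state_cong[OF ws eq] have "i = i'" "e = e'" by auto
  then show ?thesis
    using eq w w' stable_in_gens[OF i] \<sigma>_closed[OF i] by (simp add: G.val_append G.right_cancel)
qed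

section \<open>Pairs on the sphere at distance at most 2\<close>

lemma conn_one_step:
  assumes fft: "A.vertex_fellow_traveler K"
    and M: "\<And>i j e. i \<in> {1..n} \<Longrightarrow> j \<in> {1..m i} \<Longrightarrow> length (f i e j) \<le> M"
    and g: "g \<in> carrier G" "G.lev g = N" and a: "fst a \<in> S" and lev: "G.lev (g \<cdot> G.val [a]) = N"
  shows "G.conn N (4 * M + 4 + 12 * K) g (g \<cdot> G.val [a])"
proof -
  obtain w where w: "w \<in> words S" "length w = N" "G.val w = g" using G.lev_witness g by metis
  have aS: "[a] \<in> words S" using a by simp
  have g': "g \<cdot> G.val [a] \<in> carrier G" using g G.val_closed[OF aS] by simp
  obtain w' where w': "w' \<in> words S" "length w' = N" "G.val w' = g \<cdot> G.val [a]"
    using G.lev_witness[OF g'] lev by metis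
  have eq: "G.val (w @ [a]) = G.val w'" using w w' aS by (simp add: G.val_append)
  obtain y e where ye: "a = (y, e)" by (cases a)
  show ?thesis
  proof (cases y)
    case (Inl x)
    then have x: "[(x, e)] \<in> words X" "base_word [(x, e)] = [a]"
      using a ye by (auto simp: hnn_gens_def base_word_def)
    have "G.conn N (4 * M + 4 + 12 * K) (G.val w) (G.val w')"
      using conn_same_coset[OF fft M w(1,2) _ w'(1,2) _ x(1)] x(2) w w' g lev by simp
    then show ?thesis using w w' by simp
  next
    case (Inr i)
    then have "i \<in> {1..n}" using a ye by (auto simp: hnn_gens_def)
    from stable_edge_changes_level[OF w(1,2) _ w'(1,2) _ this] eq w w' g lev Inr ye
    show ?thesis by auto
  qed
qed

lemma conn_peak:
  assumes fft: "A.vertex_fellow_traveler K"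
    and M: "\<And>i j e. i \<in> {1..n} \<Longrightarrow> j \<in> {1..m i} \<Longrightarrow> length (f i e j) \<le> M"
    and g: "g \<in> carrier G" "G.lev g = N" and g': "g' \<in> carrier G" "G.lev g' = N"
    and a: "fst a \<in> S" and b: "fst b \<in> S"
    and eq: "g \<cdot> G.val [a] = g' \<cdot> G.val [b]" and peak: "G.lev (g \<cdot> G.val [a]) = N + 1"
  shows "G.conn N (4 * M + 4 + 12 * K) g g'"
proof -
  obtain w where w: "w \<in> words S" "length w = N" "G.val w = g" using G.lev_witness g by metis
  obtain w' where w': "w' \<in> words S" "length w' = N" "G.val w' = g'" using G.lev_witness g' by metis
  have ab: "[a] \<in> words S" "[b] \<in> words S" using a b by simp_all
  have val_wa: "G.val (w @ [a]) = g \<cdot> G.val [a]" using w ab by (simp add: G.val_append)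
  have val_wb: "G.val (w' @ [b]) = g' \<cdot> G.val [b]" using w' ab by (simp add: G.val_append)
  obtain y e where ye: "a = (y, e)" by (cases a)
  obtain y' e' where ye': "b = (y', e')" by (cases b)
  consider (base) x x' where "y = Inl x" "y' = Inl x'" | (left) i x' where "y = Inr i" "y' = Inl x'"
    | (right) x i' where "y = Inl x" "y' = Inr i'" | (both) i i' where "y = Inr i" "y' = Inr i'"
    by (cases y; cases y') auto
  then show ?thesis
  proof cases
    case base
    \<comment> \<open>The path over the peak itself, which leaves the ball;
      \<open>conn_same_coset\<close> requires nothing of the vertex in its middle.\<close>
    let ?\<gamma> = "[(x, e), (x', \<not> e')]"
    have x: "?\<gamma> \<in> words X" "base_word ?\<gamma> = [a] @ [letter_inv b]"
      using a b ye ye' base by (auto simp: hnn_gens_def base_word_def letter_inv_def)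
    have lb: "[letter_inv b] \<in> words S" using b by (simp add: letter_inv_def)
    have "bval ?\<gamma> = G.val [a] \<cdot> inv\<^bsub>G\<^esub> (G.val [b])"
      unfolding x(2) using ab lb b by (subst G.val_append) (auto simp: G.val_letter_inv)
    then have "g \<cdot> bval ?\<gamma> = g \<cdot> G.val [a] \<cdot> inv\<^bsub>G\<^esub> (G.val [b])"
      using g G.val_closed[OF ab(1)] G.val_closed[OF ab(2)] by (simp add: G.m_assoc)
    also have "\<dots> = g'" unfolding eq using g' G.val_closed[OF ab(2)] by (simp add: G.m_assoc)
    finally have "G.conn N (4 * M + 4 + 12 * K) (G.val w) (G.val w')"
      using conn_same_coset[OF fft M w(1,2) _ w'(1,2) _ x(1)] w w' g g' by simp
    then show ?thesis using w w' by simp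
  next
    case left
    have i: "i \<in> {1..n}" "fst (x', e') \<in> X" using a b ye ye' left by (auto simp: hnn_gens_def)
    have "base_word [(x', e')] = [b]" using ye' left by (simp add: base_word_def)
    then have "G.conn N (2 * M + 2) (G.val w) (G.val w')"
      using conn_peak_stable_base[OF M w(1,2) _ w'(1,2) _ i, of e] w w' g g' eq peak val_wa val_wb left ye by simp
    then show ?thesis using w w' by (auto intro: G.conn_mono)
  next
    case right
    have i: "i' \<in> {1..n}" "fst (x, e) \<in> X" using a b ye ye' right by (auto simp: hnn_gens_def)
    have "base_word [(x, e)] = [a]" using ye right by (simp add: base_word_def)
    then have "G.conn N (2 * M + 2) (G.val w') (G.val w)"
      using conn_peak_stable_base[OF M w'(1,2) _ w(1,2) _ i, of e'] w w' g g' eq peak val_wa val_wb right ye' by simp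
    from G.conn_mono[OF G.conn_sym[OF this], where C' = "4 * M + 4 + 12 * K"]
    show ?thesis using w w' by simp
  next
    case both
    then have i: "i \<in> {1..n}" "i' \<in> {1..n}" using a b ye ye' by (auto simp: hnn_gens_def)
    have "G.val w = G.val w'"
      using peak_stable_stable[OF w(1,2) w'(1,2) i, of e e'] val_wa val_wb eq peak both ye ye' by simp
    then show ?thesis using w w' by simp
  qed
qed

text \<open>The level of the middle vertex \<open>?h\<close> decides. The factor 2 covers the case
  that \<open>?h\<close> lies on the sphere, where each edge is replaced by a detour of its
  own.\<close>

lemma conn_sphere:
  assumes fft: "A.vertex_fellow_traveler K"
    and M: "\<And>i j e. i \<in> {1..n} \<Longrightarrow> j \<in> {1..m i} \<Longrightarrow> length (f i e j) \<le> M"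
    and g: "g \<in> carrier G" "G.lev g = N" and g': "g' \<in> carrier G" "G.lev g' = N"
    and dist: "G.gdist g g' \<le> 2"
  shows "G.conn N (2 * (4 * M + 4 + 12 * K)) g g'"
proof -
  let ?C = "4 * M + 4 + 12 * K"
  note step = conn_one_step[where K = K and M = M, OF fft M]
  obtain \<gamma> where \<gamma>: "\<gamma> \<in> words S" "length \<gamma> \<le> 2" "g \<cdot> G.val \<gamma> = g'"
    using G.gdist_witness[OF g(1) g'(1)] dist by metis
  consider "\<gamma> = []" | a where "\<gamma> = [a]" | a b where "\<gamma> = [a, b]"
    using \<gamma>(2) by (cases \<gamma>; cases "tl \<gamma>") auto
  then show ?thesis
  proof cases
    case 1
    then show ?thesis using \<gamma> g by simp
  next
    case 2
    then have "G.conn N ?C g g'" using step[of g N a] \<gamma> g g' by simp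
    then show ?thesis by (rule G.conn_mono) simp
  next
    case (3 a b)
    have ab: "[a] \<in> words S" "[b] \<in> words S" "fst a \<in> S" "fst b \<in> S" using 3 \<gamma> by simp_all
    let ?h = "g \<cdot> G.val [a]"
    have h: "?h \<in> carrier G" using g G.val_closed[OF ab(1)] by simp
    have "G.val ([a] @ [b]) = G.val [a] \<cdot> G.val [b]" using ab by (intro G.val_append)
    then have hb: "?h \<cdot> G.val [b] = g'"
      using \<gamma> 3 g G.val_closed[OF ab(1)] G.val_closed[OF ab(2)] by (simp add: G.m_assoc)
    have le: "G.lev ?h \<le> N + 1" using G.lev_mult[OF g(1) ab(1)] g by simp
    consider "G.lev ?h < N" | "G.lev ?h = N" | "G.lev ?h = N + 1" using le by linarith
    then show ?thesis
    proof cases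
      case 1
      \<comment> \<open>Here both edges are already inner, as the levels of their ends add up to
        less than \<open>2 * N\<close>.\<close>
      have "G.conn N 1 g ?h" using 1 g ab by (intro G.conn_edge) auto
      moreover have "G.conn N 1 ?h (?h \<cdot> G.val [b])" using 1 g' ab h hb by (intro G.conn_edge) auto
      ultimately have "G.conn N (1 + 1) g g'" unfolding hb by (rule G.conn_trans)
      then show ?thesis by (rule G.conn_mono) simp
    next
      case 2
      have "G.conn N ?C g ?h" using step[of g N a] g ab 2 by simp
      moreover have "G.conn N ?C ?h g'" using step[of ?h N b] h ab 2 hb g' by simp
      ultimately show ?thesis using G.conn_trans by (metis mult_2)
    next
      case 3
      have inv_b: "?h = g' \<cdot> G.val [letter_inv b]"
        unfolding hb[symmetric] using h ab G.val_closed[OF ab(2)] by (simp add: G.val_letter_inv G.m_assoc)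
      have "G.conn N ?C g g'"
        using inv_b 3 g g' ab
        by (intro conn_peak[OF fft M, where a = a and b = "letter_inv b"]) (auto simp: letter_inv_def)
      then show ?thesis by (rule G.conn_mono) simp
    qed
  qed
qed

lemma f_bounded: "\<exists>M. \<forall>i\<in>{1..n}. \<forall>j\<in>{1..m i}. \<forall>e. length (f i e j) \<le> M"
proof -
  let ?L = "(\<lambda>(i, j, e). length (f i e j)) ` (SIGMA i:{1..n}. {1..m i} \<times> UNIV)"
  have "finite ?L" by (intro finite_imageI finite_SigmaI) auto
  then obtain M where M: "\<forall>l\<in>?L. l \<le> M" unfolding finite_nat_set_iff_bounded_le ..
  have "length (f i e j) \<le> M" if "i \<in> {1..n}" "j \<in> {1..m i}" for i j e
  proof -
    have "length (f i e j) \<in> ?L" using that by (intro image_eqI[of _ _ "(i, j, e)"]) auto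
    then show ?thesis using M by blast
  qed
  then show ?thesis by blast
qed

lemma almost_convex_HNN:
  assumes "falsification_by_fellow_traveler A \<iota>A X"
  shows "almost_convex G \<iota>G S"
proof -
  obtain K where K: "A.vertex_fellow_traveler K" using A.ex_vertex_fellow_traveler[OF assms] by blast
  obtain M where M: "\<And>i j e. i \<in> {1..n} \<Longrightarrow> j \<in> {1..m i} \<Longrightarrow> length (f i e j) \<le> M"
    using f_bounded by blast
  show ?thesis
    by (rule G.almost_convexI[OF conn_sphere[OF K M]])
qed

end

theorem theorem4p1:
  fixes X :: "'x set" and R :: "'x word set" and n :: nat
    and U V :: "nat \<Rightarrow> 'x word set set" and \<phi> :: "nat \<Rightarrow> 'x word set \<Rightarrow> 'x word set"
    and m :: "nat \<Rightarrow> nat" and u v :: "nat \<Rightarrow> nat \<Rightarrow> 'x word"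
  assumes "finite X" and "finite R" and "R \<subseteq> words X"
    and "isometric_multiple_HNN X R n U V \<phi> m u v"
    and "falsification_by_fellow_traveler (presented_group X R) (presented_gen X R) X"
  shows "almost_convex
           (presented_group (hnn_gens X n) (hnn_rels R n m u v))
           (presented_gen (hnn_gens X n) (hnn_rels R n m u v))
           (hnn_gens X n)"
  using isometric_HNN.almost_convex_HNN[OF isometric_HNN.intro] assms(4,5) .

end
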